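(* For every prime $p$, the compact Lie group $G=S^1\times C_p$ does not have the weak Borsuk-Ulam property.
   Context: $S^1=\{t\in\mathbb{C}: |t|=1\}$ and $C_p$ is the cyclic group of prime order $p$. For a compact Lie group $G$ and an orthogonal $G$-representation $V$, $S(V)$ denotes the unit sphere of $V$ with the induced $G$-action. Convention: all representations considered are fixed-point-free, i.e. $V^G=0$. The Borsuk-Ulam function $b_G:\mathbb{N}\to\mathbb{N}$ is $b_G(n)=\min\{\dim W : \text{there exist fixed-point-free orthogonal } G\text{-representations } V,W \text{ and a continuous } G\text{-equivariant map } S(V)\to S(W) \text{ with } \dim V\ge n\}$. The group $G$ has the weak Borsuk-Ulam property if $b_G$ is unbounded (equivalently $\lim_{n\to\infty} b_G(n)=\infty$). *)

theory Defs
  imports "HOL-Analysis.Analysis"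
begin

text \<open>The n-dimensional Euclidean space, realised as functions nat => real vanishing
  from index n on (the product topology on nat => real restricts to the Euclidean
  topology on this subspace).\<close>
definition vecs :: "nat \<Rightarrow> (nat \<Rightarrow> real) set" where
  "vecs n = {x. \<forall>i\<ge>n. x i = 0}"

definition sqnorm :: "nat \<Rightarrow> (nat \<Rightarrow> real) \<Rightarrow> real" where
  "sqnorm n x = (\<Sum>i<n. (x i)^2)"

definition sph :: "nat \<Rightarrow> (nat \<Rightarrow> real) set" where
  "sph n = {x \<in> vecs n. sqnorm n x = 1}"

definition fpf_orth_rep ::
  "'g::topological_space set \<Rightarrow> ('g \<Rightarrow> 'g \<Rightarrow> 'g) \<Rightarrow> 'g \<Rightarrow> nat
   \<Rightarrow> ('g \<Rightarrow> (nat \<Rightarrow> real) \<Rightarrow> (nat \<Rightarrow> real)) \<Rightarrow> bool" where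
  "fpf_orth_rep G gmul e n rho \<longleftrightarrow>
     (\<forall>g\<in>G. \<forall>x\<in>vecs n. rho g x \<in> vecs n) \<and>
     (\<forall>g\<in>G. \<forall>x\<in>vecs n. \<forall>y\<in>vecs n. rho g (\<lambda>i. x i + y i) = (\<lambda>i. rho g x i + rho g y i)) \<and>
     (\<forall>g\<in>G. \<forall>c::real. \<forall>x\<in>vecs n. rho g (\<lambda>i. c * x i) = (\<lambda>i. c * rho g x i)) \<and>
     (\<forall>g\<in>G. \<forall>x\<in>vecs n. sqnorm n (rho g x) = sqnorm n x) \<and>
     (\<forall>x\<in>vecs n. rho e x = x) \<and>
     (\<forall>g\<in>G. \<forall>h\<in>G. \<forall>x\<in>vecs n. rho (gmul g h) x = rho g (rho h x)) \<and>
     continuous_on (G \<times> vecs n) (\<lambda>(g, x). rho g x) \<and>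
     (\<forall>x\<in>vecs n. (\<forall>g\<in>G. rho g x = x) \<longrightarrow> x = (\<lambda>i. 0))"

definition equiv_sphere_map ::
  "'g::topological_space set \<Rightarrow> nat \<Rightarrow> ('g \<Rightarrow> (nat \<Rightarrow> real) \<Rightarrow> (nat \<Rightarrow> real))
   \<Rightarrow> nat \<Rightarrow> ('g \<Rightarrow> (nat \<Rightarrow> real) \<Rightarrow> (nat \<Rightarrow> real))
   \<Rightarrow> ((nat \<Rightarrow> real) \<Rightarrow> (nat \<Rightarrow> real)) \<Rightarrow> bool" where
  "equiv_sphere_map G n rho m sig f \<longleftrightarrow>
     continuous_on (sph n) f \<and> f ` sph n \<subseteq> sph m \<and>
     (\<forall>g\<in>G. \<forall>x\<in>sph n. f (rho g x) = sig g (f x))"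

definition bu_fun ::
  "'g::topological_space set \<Rightarrow> ('g \<Rightarrow> 'g \<Rightarrow> 'g) \<Rightarrow> 'g \<Rightarrow> nat \<Rightarrow> nat" where
  "bu_fun G gmul e n = (LEAST d. \<exists>m rho sig f. m \<ge> n \<and>
      fpf_orth_rep G gmul e m rho \<and> fpf_orth_rep G gmul e d sig \<and>
      equiv_sphere_map G m rho d sig f)"

definition weak_BU_property ::
  "'g::topological_space set \<Rightarrow> ('g \<Rightarrow> 'g \<Rightarrow> 'g) \<Rightarrow> 'g \<Rightarrow> bool" where
  "weak_BU_property G gmul e \<longleftrightarrow> \<not> bdd_above (range (bu_fun G gmul e))"

text \<open>The group S^1 x C_p: pairs (t, k) with |t| = 1 and k in Z/p = {0..p-1};
  topology: product of the Euclidean topology on complex and the discrete one on nat.\<close>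
definition S1Cp :: "nat \<Rightarrow> (complex \<times> nat) set" where
  "S1Cp p = {t. cmod t = 1} \<times> {..<p}"

definition S1Cp_mult :: "nat \<Rightarrow> complex \<times> nat \<Rightarrow> complex \<times> nat \<Rightarrow> complex \<times> nat" where
  "S1Cp_mult p a b = (fst a * fst b, (snd a + snd b) mod p)"

end

theory Submission
  imports Defs
begin

text \<open>
  Let \<open>\<zeta>\<close> be a primitive \<open>p\<close>-th root of unity and \<open>\<chi>(a, b)\<close> the character
  \<open>(t, k) \<mapsto> t ^ a \<zeta> ^ (b k)\<close>. For suitable weights there are maps from
  \<open>S(\<chi>(a\<^sub>1, 1) + \<dots> + \<chi>(a\<^sub>n, 1))\<close> to \<open>S(W)\<close> with \<open>W = \<chi>(0, 1) + \<chi>(N, 0)\<close>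
  of real dimension 4. They are built by induction on \<open>n\<close>, together with two extensions over
  the disc: a \<open>C\<^sub>p\<close>-equivariant one, \<open>F\<close>, and an \<open>S\<^sup>1\<close>-equivariant one, \<open>T\<close>, which are
  (non-equivariantly) homotopic relative to the boundary.

  For a new coordinate \<open>w\<close> of weight 1, with the old weights multiplied by \<open>p\<close>, the translates
  of \<open>F\<close> define the map on \<open>|w| = 1\<close>. The homotopy from \<open>F\<close> to \<open>T\<close> contracts this
  loop of translates to \<open>T\<close>, because \<open>T\<close> is invariant under translation; this gives the new
  \<open>S\<^sup>1\<close>-equivariant extension, and on each of \<open>p\<close> sectors of the \<open>w\<close>-disc it gives a filling
  \<open>H\<close> whose \<open>C\<^sub>p\<close>-translates make up the new \<open>C\<^sub>p\<close>-equivariant extension. The two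
  differ by the quotients \<open>H\<^sup>-\<^sup>1 (c H)\<close> for \<open>c\<close> in \<open>C\<^sub>p\<close>, taken in the group of unit
  quaternions \<open>S(W)\<close>. All \<open>C\<^sub>p\<close>-translates of such a quotient are homotopic to it and
  their product telescopes to 1, so its \<open>p\<close>-th power is null-homotopic. Composing with
  \<open>(a, b) \<mapsto> (a, b ^ p)\<close>, which is homotopic to the \<open>p\<close>-th power of quaternions and maps
  \<open>W\<close> to a representation of the same kind, removes the difference.
\<close>

text \<open>This rule matches every continuity goal for a map into sequences and would split it into
  coordinates; it is named explicitly where that is wanted.\<close>

declare continuous_on_coordinatewise_then_product [continuous_intros del]

section \<open>Relative homotopies\<close>

definition homot_rel ::
  "'a::topological_space set \<Rightarrow> 'a set \<Rightarrow> 'b::topological_space set \<Rightarrow> ('a \<Rightarrow> 'b) \<Rightarrow> ('a \<Rightarrow> 'b) \<Rightarrow> bool" where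
  "homot_rel B X Y f g \<longleftrightarrow> (\<exists>h. continuous_on ({0..1::real} \<times> X) h \<and> h \<in> {0..1} \<times> X \<rightarrow> Y \<and>
     (\<forall>x\<in>X. h (0, x) = f x \<and> h (1, x) = g x) \<and> (\<forall>t\<in>{0..1}. \<forall>x\<in>B. h (t, x) = f x))"

lemma homot_relI:
  assumes "continuous_on ({0..1::real} \<times> X) h" "\<And>t x. t \<in> {0..1} \<Longrightarrow> x \<in> X \<Longrightarrow> h (t, x) \<in> Y"
    "\<And>x. x \<in> X \<Longrightarrow> h (0, x) = f x" "\<And>x. x \<in> X \<Longrightarrow> h (1, x) = g x"
    "\<And>t x. t \<in> {0..1} \<Longrightarrow> x \<in> B \<Longrightarrow> h (t, x) = f x"
  shows "homot_rel B X Y f g"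
  unfolding homot_rel_def using assms by blast

lemma homot_relE:
  assumes "homot_rel B X Y f g"
  obtains h where "continuous_on ({0..1::real} \<times> X) h" "\<And>t x. t \<in> {0..1} \<Longrightarrow> x \<in> X \<Longrightarrow> h (t, x) \<in> Y"
    "\<And>x. x \<in> X \<Longrightarrow> h (0, x) = f x" "\<And>x. x \<in> X \<Longrightarrow> h (1, x) = g x"
    "\<And>t x. t \<in> {0..1} \<Longrightarrow> x \<in> B \<Longrightarrow> h (t, x) = f x"
  using assms unfolding homot_rel_def by blast

lemma homot_rel_imp:
  assumes "homot_rel B X Y f g"
  shows "continuous_on X f" "continuous_on X g" "\<And>x. x \<in> X \<Longrightarrow> f x \<in> Y"
    "\<And>x. x \<in> X \<Longrightarrow> g x \<in> Y" "B \<subseteq> X \<Longrightarrow> x \<in> B \<Longrightarrow> g x = f x"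
proof -
  obtain h where h: "continuous_on ({0..1::real} \<times> X) h" "\<And>t x. t \<in> {0..1} \<Longrightarrow> x \<in> X \<Longrightarrow> h (t, x) \<in> Y"
    "\<And>x. x \<in> X \<Longrightarrow> h (0, x) = f x" "\<And>x. x \<in> X \<Longrightarrow> h (1, x) = g x"
    "\<And>t x. t \<in> {0..1} \<Longrightarrow> x \<in> B \<Longrightarrow> h (t, x) = f x"
    by (fact homot_relE [OF assms])
  have c: "continuous_on X (\<lambda>x. h (t, x))" if "t \<in> {0..1}" for t
    by (rule continuous_on_compose2 [OF h(1)]) (use that in \<open>auto intro!: continuous_intros\<close>)
  show "continuous_on X f" using c [of 0] h(3) by (simp cong: continuous_on_cong)
  show "continuous_on X g" using c [of 1] h(4) by (simp cong: continuous_on_cong)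
  show "f x \<in> Y" if "x \<in> X" for x using h(2) [of 0 x] h(3) that by simp
  show "g x \<in> Y" if "x \<in> X" for x using h(2) [of 1 x] h(4) that by simp
  show "g x = f x" if "B \<subseteq> X" "x \<in> B" using h(4) [of x] h(5) [of 1 x] that by auto
qed

lemma homot_rel_cong:
  assumes "homot_rel B X Y f g" "B \<subseteq> X" "\<And>x. x \<in> X \<Longrightarrow> f' x = f x" "\<And>x. x \<in> X \<Longrightarrow> g' x = g x"
  shows "homot_rel B X Y f' g'"
  using assms unfolding homot_rel_def by (metis subsetD)

lemma homot_rel_sym:
  assumes "homot_rel B X Y f g" "B \<subseteq> X"
  shows "homot_rel B X Y g f"
proof -
  obtain h where h: "continuous_on ({0..1::real} \<times> X) h" "\<And>t x. t \<in> {0..1} \<Longrightarrow> x \<in> X \<Longrightarrow> h (t, x) \<in> Y"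
    "\<And>x. x \<in> X \<Longrightarrow> h (0, x) = f x" "\<And>x. x \<in> X \<Longrightarrow> h (1, x) = g x"
    "\<And>t x. t \<in> {0..1} \<Longrightarrow> x \<in> B \<Longrightarrow> h (t, x) = f x"
    by (fact homot_relE [OF assms(1)])
  show ?thesis
  proof (rule homot_relI [where h = "\<lambda>z. h (1 - fst z, snd z)"])
    show "continuous_on ({0..1} \<times> X) (\<lambda>z. h (1 - fst z, snd z))"
      by (rule continuous_on_compose2 [OF h(1)]) (auto intro!: continuous_intros)
  qed (use h(2-5) homot_rel_imp(5) [OF assms] in auto)
qed

lemma homot_rel_trans:
  assumes "homot_rel B X Y f g" "homot_rel B X Y g k" "B \<subseteq> X"
  shows "homot_rel B X Y f k"
proof -
  obtain h1 where h1: "continuous_on ({0..1::real} \<times> X) h1" "\<And>t x. t \<in> {0..1} \<Longrightarrow> x \<in> X \<Longrightarrow> h1 (t, x) \<in> Y"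
    "\<And>x. x \<in> X \<Longrightarrow> h1 (0, x) = f x" "\<And>x. x \<in> X \<Longrightarrow> h1 (1, x) = g x"
    "\<And>t x. t \<in> {0..1} \<Longrightarrow> x \<in> B \<Longrightarrow> h1 (t, x) = f x"
    by (fact homot_relE [OF assms(1)])
  obtain h2 where h2: "continuous_on ({0..1::real} \<times> X) h2" "\<And>t x. t \<in> {0..1} \<Longrightarrow> x \<in> X \<Longrightarrow> h2 (t, x) \<in> Y"
    "\<And>x. x \<in> X \<Longrightarrow> h2 (0, x) = g x" "\<And>x. x \<in> X \<Longrightarrow> h2 (1, x) = k x"
    "\<And>t x. t \<in> {0..1} \<Longrightarrow> x \<in> B \<Longrightarrow> h2 (t, x) = g x"
    by (fact homot_relE [OF assms(2)])
  define h where "h = (\<lambda>z. if fst z \<le> (1/2::real) then h1 (2 * fst z, snd z) else h2 (2 * fst z - 1, snd z))"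
  show ?thesis
  proof (rule homot_relI [where h = h])
    show "continuous_on ({0..1} \<times> X) h" unfolding h_def
      by (rule continuous_on_cases_le)
         (auto intro!: continuous_intros continuous_on_compose2 [OF h1(1)] continuous_on_compose2 [OF h2(1)] simp: h1 h2 mult.commute [of _ 2])
    show "h (t, x) = f x" if "t \<in> {0..1}" "x \<in> B" for t x
      using that h1(5) h2(5) homot_rel_imp(5) [OF assms(1,3)] by (auto simp: h_def)
  qed (use h1 h2 in \<open>auto simp: h_def\<close>)
qed

lemma homot_rel_compose_left:
  assumes "homot_rel B X Y f g" "continuous_on Y \<phi>" "\<And>y. y \<in> Y \<Longrightarrow> \<phi> y \<in> Z"
  shows "homot_rel B X Z (\<lambda>x. \<phi> (f x)) (\<lambda>x. \<phi> (g x))"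
proof -
  obtain h where h: "continuous_on ({0..1::real} \<times> X) h" "\<And>t x. t \<in> {0..1} \<Longrightarrow> x \<in> X \<Longrightarrow> h (t, x) \<in> Y"
    "\<And>x. x \<in> X \<Longrightarrow> h (0, x) = f x" "\<And>x. x \<in> X \<Longrightarrow> h (1, x) = g x"
    "\<And>t x. t \<in> {0..1} \<Longrightarrow> x \<in> B \<Longrightarrow> h (t, x) = f x"
    by (fact homot_relE [OF assms(1)])
  show ?thesis
    by (rule homot_relI [where h = "\<lambda>z. \<phi> (h z)"])
       (use h assms(3) in \<open>auto intro!: continuous_on_compose2 [OF assms(2) h(1)]\<close>)
qed

lemma homot_rel_compose_right:
  assumes "homot_rel B X Y f g" "continuous_on X' k" "\<And>x. x \<in> X' \<Longrightarrow> k x \<in> X" "\<And>x. x \<in> B' \<Longrightarrow> k x \<in> B"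
  shows "homot_rel B' X' Y (\<lambda>x. f (k x)) (\<lambda>x. g (k x))"
proof -
  obtain h where h: "continuous_on ({0..1::real} \<times> X) h" "\<And>t x. t \<in> {0..1} \<Longrightarrow> x \<in> X \<Longrightarrow> h (t, x) \<in> Y"
    "\<And>x. x \<in> X \<Longrightarrow> h (0, x) = f x" "\<And>x. x \<in> X \<Longrightarrow> h (1, x) = g x"
    "\<And>t x. t \<in> {0..1} \<Longrightarrow> x \<in> B \<Longrightarrow> h (t, x) = f x"
    by (fact homot_relE [OF assms(1)])
  show ?thesis
  proof (rule homot_relI [where h = "\<lambda>z. h (fst z, k (snd z))"])
    show "continuous_on ({0..1} \<times> X') (\<lambda>z. h (fst z, k (snd z)))"
      by (rule continuous_on_compose2 [OF h(1)])
         (use assms(3) in \<open>auto intro!: continuous_intros continuous_on_compose2 [OF assms(2)]\<close>)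
  qed (use h assms(3,4) in auto)
qed

section \<open>Unit quaternions\<close>

text \<open>The pair \<open>(a, b)\<close> stands for the quaternion \<open>b + a j\<close>; with this convention the
  action of \<open>C\<^sub>p\<close> on \<open>a\<close> is conjugation by a unit complex number.\<close>

type_synonym quat = "complex \<times> complex"

definition S3 :: "quat set" where "S3 = sphere 0 1"

definition qmul :: "quat \<Rightarrow> quat \<Rightarrow> quat" where
  "qmul x y = (snd x * fst y + fst x * cnj (snd y), snd x * snd y - fst x * cnj (fst y))"

definition qinv :: "quat \<Rightarrow> quat" where "qinv x = (- fst x, cnj (snd x))"

abbreviation qone :: quat where "qone \<equiv> (0, 1)"

lemma S3_iff: "x \<in> S3 \<longleftrightarrow> (norm (fst x))\<^sup>2 + (norm (snd x))\<^sup>2 = 1"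
  by (cases x) (simp add: S3_def norm_Pair real_sqrt_eq_1_iff)

lemma S3_iff_cnj: "x \<in> S3 \<longleftrightarrow> fst x * cnj (fst x) + snd x * cnj (snd x) = 1"
proof -
  have "fst x * cnj (fst x) + snd x * cnj (snd x) = of_real ((norm (fst x))\<^sup>2 + (norm (snd x))\<^sup>2)"
    by (simp only: of_real_add complex_norm_square)
  then show ?thesis unfolding S3_iff using of_real_eq_1_iff by metis
qed

lemma qone_S3 [simp]: "qone \<in> S3" by (simp add: S3_iff)

lemma qmul_assoc: "qmul (qmul x y) z = qmul x (qmul y z)"
  by (simp add: qmul_def algebra_simps)

lemma qmul_qone [simp]: "qmul qone x = x" "qmul x qone = x"
  by (simp_all add: qmul_def)

lemma of_real_norm_quat: "complex_of_real ((norm x)\<^sup>2) = fst x * cnj (fst x) + snd x * cnj (snd x)" for x :: quat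
  by (cases x) (simp only: norm_Pair real_sqrt_pow2 add_nonneg_nonneg zero_le_power2 of_real_add complex_norm_square fst_conv snd_conv)

lemma norm_qmul: "norm (qmul x y) = norm x * norm y"
proof -
  have "complex_of_real ((norm (qmul x y))\<^sup>2) = of_real ((norm x)\<^sup>2) * of_real ((norm y)\<^sup>2)"
    unfolding of_real_norm_quat by (simp add: qmul_def algebra_simps)
  then have "(norm (qmul x y))\<^sup>2 = (norm x * norm y)\<^sup>2"
    by (metis of_real_eq_iff of_real_mult power_mult_distrib)
  then show ?thesis by (simp add: power2_eq_iff_nonneg)
qed

lemma qmul_S3 [simp]: "x \<in> S3 \<Longrightarrow> y \<in> S3 \<Longrightarrow> qmul x y \<in> S3"
  by (simp add: S3_def norm_qmul)

lemma qinv_S3 [simp]: "x \<in> S3 \<Longrightarrow> qinv x \<in> S3"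
  unfolding S3_iff by (simp add: qinv_def)

lemma qinv_qone [simp]: "qinv qone = qone" by (simp add: qinv_def)

lemma qmul_qinv [simp]: assumes "x \<in> S3" shows "qmul x (qinv x) = qone" "qmul (qinv x) x = qone"
  using assms unfolding S3_iff_cnj by (auto simp: qmul_def qinv_def algebra_simps)

lemma qmul_qinv_cancel [simp]:
  assumes "x \<in> S3" shows "qmul x (qmul (qinv x) y) = y" "qmul (qinv x) (qmul x y) = y"
  using assms by (simp_all flip: qmul_assoc)

lemma continuous_on_qmul [continuous_intros]:
  assumes "continuous_on X f" "continuous_on X g" shows "continuous_on X (\<lambda>x. qmul (f x) (g x))"
  unfolding qmul_def by (intro continuous_intros assms)

lemma continuous_on_qinv [continuous_intros]:
  assumes "continuous_on X f" shows "continuous_on X (\<lambda>x. qinv (f x))"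
  unfolding qinv_def by (intro continuous_intros assms)

section \<open>Power maps on the unit quaternions\<close>

fun qpow :: "nat \<Rightarrow> quat \<Rightarrow> quat" where
  "qpow 0 x = qone"
| "qpow (Suc k) x = qmul (qpow k x) x"

lemma qpow_S3 [simp]: "x \<in> S3 \<Longrightarrow> qpow k x \<in> S3"
  by (induction k) simp_all

lemma qpow_qone [simp]: "qpow k qone = qone"
  by (induction k) simp_all

lemma continuous_on_qpow [continuous_intros]:
  "continuous_on X f \<Longrightarrow> continuous_on X (\<lambda>x. qpow k (f x))"
  by (induction k) (auto intro!: continuous_intros)

text \<open>A substitute for \<open>qpow k\<close> in its homotopy class. Both commute with
  \<open>sig\<close> for unit factors, but in general only \<open>phi\<close> turns
  \<open>tau c\<close> into \<open>tau (c ^ k)\<close>, so composing with it keeps both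
  equivariances.\<close>

definition phi :: "nat \<Rightarrow> quat \<Rightarrow> quat" where
  "phi k x = sgn (fst x, snd x ^ k)"

lemma phi_nz: "x \<in> S3 \<Longrightarrow> (fst x, snd x ^ k) \<noteq> (0 :: quat)"
  unfolding S3_iff by (auto simp: zero_prod_def)

lemma sgn_S3 [simp]: "x \<noteq> 0 \<Longrightarrow> sgn x \<in> S3" for x :: quat
  by (simp add: S3_def norm_sgn)

lemma phi_S3 [simp]: "x \<in> S3 \<Longrightarrow> phi k x \<in> S3"
  unfolding phi_def using phi_nz sgn_S3 by blast

lemma continuous_on_phi: "continuous_on S3 (phi k)"
  unfolding phi_def sgn_div_norm
  by (intro continuous_intros) (use phi_nz in \<open>auto simp: zero_prod_def\<close>)

lemma homot_rel_sgn:
  fixes h :: "real \<times> 'a::topological_space \<Rightarrow> quat"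
  assumes "continuous_on ({0..1} \<times> X) h" "\<And>t x. t \<in> {0..1} \<Longrightarrow> x \<in> X \<Longrightarrow> h (t, x) \<noteq> 0"
  shows "homot_rel {} X S3 (\<lambda>x. sgn (h (0, x))) (\<lambda>x. sgn (h (1, x)))"
proof (rule homot_relI [where h = "\<lambda>z. sgn (h z)"])
  show "continuous_on ({0..1} \<times> X) (\<lambda>z. sgn (h z))" unfolding sgn_div_norm
    by (intro continuous_intros assms) (use assms in auto)
qed (use assms sgn_S3 in auto)


lemma qmul_sgn: "x \<in> S3 \<Longrightarrow> qmul (sgn y) x = sgn (qmul y x)"
  by (simp add: sgn_div_norm norm_qmul S3_def) (simp add: qmul_def scaleR_conv_of_real algebra_simps)

text \<open>Taking norms gives \<open>norm b ^ m + (norm b)\<^sup>2 = 1\<close>, whose left side is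
  strictly increasing in \<open>norm b\<close>. So all solutions have the same norm and are
  \<open>m\<close>-th roots of a single number.\<close>

lemma finite_power_eq_one_minus:
  assumes "0 < m"
  shows "finite {b :: complex. norm b \<le> 1 \<and> b ^ m = of_real (1 - (norm b)\<^sup>2)}" (is "finite ?R")
proof (cases "?R = {}")
  case False
  then obtain c where c: "c \<in> ?R" by blast
  have eq: "norm b ^ m + (norm b)\<^sup>2 = 1" if "b \<in> ?R" for b :: complex
  proof -
    have "norm b ^ m = \<bar>1 - (norm b)\<^sup>2\<bar>"
      using that by (metis (mono_tags, lifting) mem_Collect_eq norm_of_real norm_power)
    then show ?thesis using that by (simp add: power_le_one)
  qed
  have "norm b = norm c" if b: "b \<in> ?R" for b
  proof (rule ccontr)
    have less: False if "norm x < norm y" "x \<in> ?R" "y \<in> ?R" for x y :: complex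
    proof -
      have "norm x ^ m < norm y ^ m" "(norm x)\<^sup>2 < (norm y)\<^sup>2"
        using that(1) assms by (auto intro!: power_strict_mono)
      then show False using eq [OF that(2)] eq [OF that(3)] by linarith
    qed
    assume "norm b \<noteq> norm c"
    then have "norm b < norm c \<or> norm c < norm b" by linarith
    then show False using less [OF _ b c] less [OF _ c b] by blast
  qed
  then have "?R \<subseteq> {b. b ^ m = of_real (1 - (norm c)\<^sup>2)}"
    by (smt (verit, ccfv_threshold) mem_Collect_eq subsetI)
  then show ?thesis by (rule finite_subset) (rule finite_nth_roots [OF assms])
next
  case True
  then show ?thesis by (simp only: finite.emptyI)
qed

text \<open>Multiplying \<open>(a, b ^ k)\<close> by the quaternion \<open>(a, b)\<close> gives
  \<open>(a (b ^ k + cnj b), b ^ (k + 1) - |a|\<^sup>2)\<close>. The second component vanishes on finitely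
  many rays only, and there the factor \<open>b ^ k + cnj b\<close> can be rotated to 1.\<close>

lemma homot_phi_Suc: "homot_rel {} S3 S3 (phi (Suc k)) (\<lambda>x. qmul (phi k x) x)"
proof -
  define R where "R = {b :: complex. norm b \<le> 1 \<and> b ^ Suc k = of_real (1 - (norm b)\<^sup>2)}"
  have "finite R" unfolding R_def by (rule finite_power_eq_one_minus) simp
  \<comment> \<open>\<open>Arg\<close> is discontinuous, but only its values on the finite set
    \<open>R\<close> matter, where every function is continuous; Tietze extends them to
    \<open>L\<close>.\<close>
  then obtain L where L: "continuous_on UNIV L" "\<And>b. b \<in> R \<Longrightarrow> L b = Arg b"
    using Tietze_unbounded [of R Arg UNIV] by (auto intro: continuous_on_finite simp: finite_imp_closed)
  \<comment> \<open>Three stages: deform the factor \<open>b ^ k + cnj b\<close> to the phase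
    \<open>cis (- L b)\<close>, rotate this phase to 1, then remove \<open>(norm a)\<^sup>2\<close>
    from the second component.\<close>
  define h1 where "h1 = (\<lambda>(v::real, a::complex, b::complex). (a * ((1 - v) * (b ^ k + cnj b) + v * cis (- L b)), b ^ Suc k - of_real ((norm a)\<^sup>2)))"
  define h2 where "h2 = (\<lambda>(v::real, a::complex, b::complex). (a * cis (- (1 - v) * L b), b ^ Suc k - of_real ((norm a)\<^sup>2)))"
  define h3 where "h3 = (\<lambda>(v::real, a::complex, b::complex). (a, b ^ Suc k - (1 - v) * of_real ((norm a)\<^sup>2)))"
  have cL [continuous_intros]: "continuous_on X (\<lambda>x. L (f x))" if "continuous_on X f" for X :: "(real \<times> quat) set" and f
    by (rule continuous_on_compose2 [OF L(1) that]) auto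
  have S3D: "norm b \<le> 1 \<and> (norm a)\<^sup>2 = 1 - (norm b)\<^sup>2 \<and> (a = 0 \<longrightarrow> b \<noteq> 0)" if "(a, b) \<in> S3" for a b
  proof -
    have *: "(norm a)\<^sup>2 + (norm b)\<^sup>2 = 1" using that by (simp add: S3_iff)
    then have "(norm b)\<^sup>2 \<le> 1" by (metis le_add_same_cancel2 zero_le_power2)
    with * show ?thesis by (auto simp: abs_square_le_1)
  qed
  have c: "continuous_on ({0..1} \<times> S3) h1" "continuous_on ({0..1} \<times> S3) h2" "continuous_on ({0..1} \<times> S3) h3"
    unfolding h1_def h2_def h3_def case_prod_unfold by (intro continuous_intros)+
  have "h1 (v, x) \<noteq> 0" if v: "v \<in> {0..1}" and x: "x \<in> S3" for v x
  proof
    assume z: "h1 (v, x) = 0"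
    obtain a b where ab: "x = (a, b)" by fastforce
    have "b ^ Suc k = of_real ((norm a)\<^sup>2)" using z by (simp add: h1_def ab zero_prod_def)
    moreover have "(norm a)\<^sup>2 = 1 - (norm b)\<^sup>2" and b1: "norm b \<le> 1" and ab0: "a = 0 \<longrightarrow> b \<noteq> 0"
      using S3D [of a b] x ab by blast+
    ultimately have bk: "b ^ Suc k = of_real (1 - (norm b)\<^sup>2)" by metis
    then have "b \<in> R" using b1 by (simp add: R_def)
    then have L': "L b = Arg b" by (rule L)
    have a: "a \<noteq> 0" and "b \<noteq> 0"
      using ab0 \<open>b ^ Suc k = of_real ((norm a)\<^sup>2)\<close> by auto
    have b: "b = norm b * cis (Arg b)" using \<open>b \<noteq> 0\<close> by (metis rcis_cmod_Arg rcis_def)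
    \<comment> \<open>After multiplication by \<open>b\<close> the ends \<open>cis (- L b)\<close>
      and \<open>b ^ k + cnj b\<close> of the segment become the positive reals
      \<open>norm b\<close> and 1, so the segment misses 0.\<close>
    have 1: "cis (- L b) * b = norm b"
      by (subst (2) b) (simp add: L' cis_mult mult.left_commute)
    have 2: "(b ^ k + cnj b) * b = of_real (1 - (norm b)\<^sup>2 + (norm b)\<^sup>2)"
      using bk by (simp only: of_real_add complex_norm_square) (simp add: algebra_simps)
    have "((1 - v) * (b ^ k + cnj b) + v * cis (- L b)) * b = of_real ((1 - v) + v * norm b)"
      using 1 2 by (simp add: distrib_right mult.assoc)
    moreover have "(1 - v) + v * norm b > 0"
      using v \<open>b \<noteq> 0\<close> by (cases "v = 1") (auto intro!: add_pos_nonneg)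
    ultimately have "(1 - v) * (b ^ k + cnj b) + v * cis (- L b) \<noteq> 0"
      by (metis mult_zero_left of_real_eq_0_iff order_less_irrefl)
    then show False using z a by (simp add: h1_def ab zero_prod_def)
  qed
  moreover have "h2 (v, x) \<noteq> 0" "h3 (v, x) \<noteq> 0" if "x \<in> S3" for v x
    using that S3D by (cases x; auto simp: h2_def h3_def zero_prod_def)+
  ultimately have hom: "homot_rel {} S3 S3 (\<lambda>x. sgn (h1 (0, x))) (\<lambda>x. sgn (h1 (1, x)))"
      "homot_rel {} S3 S3 (\<lambda>x. sgn (h2 (0, x))) (\<lambda>x. sgn (h2 (1, x)))"
      "homot_rel {} S3 S3 (\<lambda>x. sgn (h3 (0, x))) (\<lambda>x. sgn (h3 (1, x)))"
    using c by (intro homot_rel_sgn; blast)+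
  have e: "h1 (1, x) = h2 (0, x)" "h2 (1, x) = h3 (0, x)" "sgn (h3 (1, x)) = phi (Suc k) x" for x
    by (auto simp: h1_def h2_def h3_def phi_def split: prod.split)
  have "sgn (h1 (0, x)) = qmul (phi k x) x" if "x \<in> S3" for x
    unfolding phi_def qmul_sgn [OF that]
    by (cases x) (simp add: h1_def qmul_def complex_norm_square algebra_simps del: of_real_power)
  note s = this
  have "homot_rel {} S3 S3 (\<lambda>x. sgn (h1 (0, x))) (phi (Suc k))"
    using homot_rel_trans [OF homot_rel_trans [OF hom(1) hom(2) [folded e(1)]]] hom(3) by (simp add: e)
  then have "homot_rel {} S3 S3 (\<lambda>x. qmul (phi k x) x) (phi (Suc k))"
    by (rule homot_rel_cong) (use s in auto)
  then show ?thesis by (simp add: homot_rel_sym)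
qed

lemma homot_phi_qpow: "homot_rel {} S3 S3 (phi k) (qpow k)"
proof (induction k)
  case 0
  \<comment> \<open>For \<open>k = 0\<close> the second component is the constant 1, so
    \<open>a\<close> can be shrunk to 0.\<close>
  have "homot_rel {} S3 S3 (\<lambda>x. sgn ((\<lambda>(t, x). ((1 - of_real t) * fst x, 1)) (0, x)))
     (\<lambda>x. sgn ((\<lambda>(t, x). ((1 - of_real t) * fst x, 1)) (1, x)))"
    by (rule homot_rel_sgn) (auto simp: case_prod_unfold zero_prod_def intro!: continuous_intros)
  then show ?case by (rule homot_rel_cong) (auto simp: phi_def sgn_div_norm norm_Pair)
next
  case (Suc k)
  obtain h where h: "continuous_on ({0..1::real} \<times> S3) h" "\<And>t x. t \<in> {0..1} \<Longrightarrow> x \<in> S3 \<Longrightarrow> h (t, x) \<in> S3"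
    "\<And>x. x \<in> S3 \<Longrightarrow> h (0, x) = phi k x" "\<And>x. x \<in> S3 \<Longrightarrow> h (1, x) = qpow k x"
    "\<And>t x. t \<in> {0..1} \<Longrightarrow> x \<in> {} \<Longrightarrow> h (t, x) = phi k x"
    by (fact homot_relE [OF Suc])
  have "homot_rel {} S3 S3 (\<lambda>x. qmul (phi k x) x) (qpow (Suc k))"
    by (rule homot_relI [where h = "\<lambda>z. qmul (h z) (snd z)"]) (use h in \<open>auto intro!: continuous_intros\<close>)
  with homot_phi_Suc show ?case by (rule homot_rel_trans) simp
qed

text \<open>Turns free homotopies into a relative one: where \<open>E\<close> is 1, the quotient of
  \<open>c (h E)\<close> by \<open>c h\<close> is 1 whatever \<open>c\<close> and \<open>h\<close>
  are, so it cannot move on \<open>B\<close>.\<close>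

lemma homot_rel_twist:
  assumes E: "continuous_on X E" "\<And>x. x \<in> X \<Longrightarrow> E x \<in> S3" "\<And>x. x \<in> B \<Longrightarrow> E x = qone" and "B \<subseteq> X"
    and "homot_rel {} X S3 h0 h1" "homot_rel {} S3 S3 c0 c1"
  shows "homot_rel B X S3 (\<lambda>x. qmul (qinv (c0 (h0 x))) (c0 (qmul (h0 x) (E x))))
     (\<lambda>x. qmul (qinv (c1 (h1 x))) (c1 (qmul (h1 x) (E x))))"
proof -
  obtain h where h: "continuous_on ({0..1::real} \<times> X) h" "\<And>t x. t \<in> {0..1} \<Longrightarrow> x \<in> X \<Longrightarrow> h (t, x) \<in> S3"
    "\<And>x. x \<in> X \<Longrightarrow> h (0, x) = h0 x" "\<And>x. x \<in> X \<Longrightarrow> h (1, x) = h1 x"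
    "\<And>t x. t \<in> {0..1} \<Longrightarrow> x \<in> {} \<Longrightarrow> h (t, x) = h0 x"
    by (fact homot_relE [OF assms(5)])
  obtain c where c: "continuous_on ({0..1::real} \<times> S3) c" "\<And>t x. t \<in> {0..1} \<Longrightarrow> x \<in> S3 \<Longrightarrow> c (t, x) \<in> S3"
    "\<And>x. x \<in> S3 \<Longrightarrow> c (0, x) = c0 x" "\<And>x. x \<in> S3 \<Longrightarrow> c (1, x) = c1 x"
    "\<And>t x. t \<in> {0..1} \<Longrightarrow> x \<in> {} \<Longrightarrow> c (t, x) = c0 x"
    by (fact homot_relE [OF assms(6)])
  let ?k = "\<lambda>z. qmul (qinv (c (fst z, h z))) (c (fst z, qmul (h z) (E (snd z))))"
  have one: "qmul (qinv (c (t, h (t, x)))) (c (t, qmul (h (t, x)) (E x))) = qone"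
    if "t \<in> {0..1}" "x \<in> B" for t x
    using that h(2) c(2) E(3) \<open>B \<subseteq> X\<close> by (simp add: subset_iff)
  show ?thesis
  proof (rule homot_relI [where h = ?k])
    have "continuous_on ({0..1} \<times> X) (\<lambda>z. E (snd z))"
      by (rule continuous_on_compose2 [OF E(1)]) (auto intro!: continuous_intros)
    then show "continuous_on ({0..1} \<times> X) ?k"
      using h(1,2) E(2)
      by (intro continuous_intros continuous_on_compose2 [OF c(1)]) (auto intro!: continuous_intros)
    show "?k (t, x) = qmul (qinv (c0 (h0 x))) (c0 (qmul (h0 x) (E x)))" if "t \<in> {0..1}" "x \<in> B" for t x
    proof -
      have "x \<in> X" using that \<open>B \<subseteq> X\<close> by blast
      then have "h0 x \<in> S3" "E x \<in> S3" using h(2) [of 0 x] h(3) E(2) by auto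
      then show ?thesis using one [OF that] one [of 0 x] that \<open>x \<in> X\<close> by (simp add: h(3) c(3))
    qed
    show "?k (0, x) = qmul (qinv (c0 (h0 x))) (c0 (qmul (h0 x) (E x)))" if "x \<in> X" for x
      using that h(2) [of 0 x] E(2) by (simp add: h(3) c(3))
    show "?k (1, x) = qmul (qinv (c1 (h1 x))) (c1 (qmul (h1 x) (E x)))" if "x \<in> X" for x
      using that h(2) [of 1 x] E(2) by (simp add: h(4) c(4))
  qed (use h(2) c(2) E(2) in auto)
qed

lemma homot_rel_qmul_left:
  assumes "homot_rel B X S3 f g" "continuous_on X k" "\<And>x. x \<in> X \<Longrightarrow> k x \<in> S3"
  shows "homot_rel B X S3 (\<lambda>x. qmul (k x) (f x)) (\<lambda>x. qmul (k x) (g x))"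
proof -
  obtain h where h: "continuous_on ({0..1::real} \<times> X) h" "\<And>t x. t \<in> {0..1} \<Longrightarrow> x \<in> X \<Longrightarrow> h (t, x) \<in> S3"
    "\<And>x. x \<in> X \<Longrightarrow> h (0, x) = f x" "\<And>x. x \<in> X \<Longrightarrow> h (1, x) = g x"
    "\<And>t x. t \<in> {0..1} \<Longrightarrow> x \<in> B \<Longrightarrow> h (t, x) = f x"
    by (fact homot_relE [OF assms(1)])
  have "continuous_on ({0..1} \<times> X) (\<lambda>z. k (snd z))"
    by (rule continuous_on_compose2 [OF assms(2)]) (auto intro!: continuous_intros)
  then show ?thesis
    by (intro homot_relI [where h = "\<lambda>z. qmul (k (snd z)) (h z)"])
       (use h assms(3) in \<open>auto intro!: continuous_intros\<close>)
qed

lemma path_connected_S3: "path_connected S3"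
  unfolding S3_def by (rule path_connected_sphere) simp

text \<open>Contracting the domain makes \<open>f\<close> constant; a path in \<open>S3\<close> then
  moves the constant to 1.\<close>

lemma homot_rel_const_S3:
  assumes X: "X \<noteq> {}" and f: "continuous_on X f" "\<And>x. x \<in> X \<Longrightarrow> f x \<in> S3"
    and c: "continuous_on ({0..1::real} \<times> X) c" "\<And>t x. t \<in> {0..1} \<Longrightarrow> x \<in> X \<Longrightarrow> c (t, x) \<in> X"
      "\<And>x. x \<in> X \<Longrightarrow> c (0, x) = x" "\<And>x. x \<in> X \<Longrightarrow> c (1, x) = x0"
  shows "homot_rel {} X S3 f (\<lambda>x. qone)"
proof -
  have "x0 \<in> X" using X c(2) [of 1] c(4) by fastforce
  then have "f x0 \<in> S3" by (rule f)
  then obtain g where g: "path g" "path_image g \<subseteq> S3" "pathstart g = f x0" "pathfinish g = qone"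
    using path_connected_S3 qone_S3 unfolding path_connected_def by blast
  have "homot_rel {} X S3 f (\<lambda>x. f x0)"
    by (rule homot_relI [where h = "\<lambda>z. f (c z)"])
       (use c f in \<open>auto intro!: continuous_on_compose2 [OF f(1) c(1)]\<close>)
  moreover have "homot_rel {} X S3 (\<lambda>x. f x0) (\<lambda>x. qone)"
  proof (rule homot_relI [where h = "\<lambda>z. g (fst z)"])
    show "continuous_on ({0..1} \<times> X) (\<lambda>z. g (fst z))"
      by (rule continuous_on_compose2 [OF g(1) [unfolded path_def]]) (auto intro!: continuous_intros)
  qed (use g in \<open>auto simp: pathstart_def pathfinish_def path_image_def\<close>)
  ultimately show ?thesis by (rule homot_rel_trans) simp
qed

section \<open>Gluing over the sectors of a disc\<close>

text \<open>The preimage of a closed set is a finite union of images of compact sets, hence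
  relatively closed. The maps \<open>\<pi> j\<close> may fail to be injective, as polar coordinates
  do at the origin.\<close>

lemma continuous_on_finite_compact_cover:
  fixes f :: "'a::t2_space \<Rightarrow> 'b::topological_space" and \<pi> :: "'j \<Rightarrow> 'k::topological_space \<Rightarrow> 'a"
  assumes "finite J" "compact K" "\<And>j. j \<in> J \<Longrightarrow> continuous_on K (\<pi> j)"
    "\<And>j. j \<in> J \<Longrightarrow> continuous_on K (\<lambda>k. f (\<pi> j k))"
  shows "continuous_on (\<Union>j\<in>J. \<pi> j ` K) f"
  unfolding continuous_on_closed_invariant
proof (intro allI impI)
  fix C :: "'b set" assume "closed C"
  define D where "D j = \<pi> j ` (K \<inter> (\<lambda>k. f (\<pi> j k)) -` C)" for j
  have "compact (D j)" if "j \<in> J" for j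
  proof -
    have "compact (K \<inter> (\<lambda>k. f (\<pi> j k)) -` C)"
      using closedin_compact [OF assms(2) continuous_closedin_preimage [OF assms(4) [OF that] \<open>closed C\<close>]] .
    then show ?thesis unfolding D_def
      by (rule compact_continuous_image [rotated]) (rule continuous_on_subset [OF assms(3) [OF that]], auto)
  qed
  then have "closed (\<Union>j\<in>J. D j)" using assms(1) by (auto intro: compact_imp_closed)
  moreover have "(\<Union>j\<in>J. D j) \<inter> (\<Union>j\<in>J. \<pi> j ` K) = f -` C \<inter> (\<Union>j\<in>J. \<pi> j ` K)"
    unfolding D_def by auto
  ultimately show "\<exists>A. closed A \<and> A \<inter> (\<Union>j\<in>J. \<pi> j ` K) = f -` C \<inter> (\<Union>j\<in>J. \<pi> j ` K)" by blast
qed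

text \<open>Polar coordinates on the \<open>j\<close>-th of \<open>p\<close> equal sectors, with
  \<open>s\<close> running from 0 to 1 across it. Any natural number \<open>j\<close> is allowed, so
  that \<open>Suc j\<close> always names the next sector cyclically.\<close>

definition pol :: "nat \<Rightarrow> nat \<Rightarrow> real \<Rightarrow> real \<Rightarrow> complex" where
  "pol p j r s = of_real r * cis (2 * pi * (s + real j) / real p)"

lemma norm_pol [simp]: "norm (pol p j r s) = \<bar>r\<bar>"
  by (simp add: pol_def norm_mult)

lemma pol_one: "pol p j r 1 = pol p (Suc j) r 0"
  by (simp add: pol_def add.commute)

lemma pol_add: "0 < p \<Longrightarrow> pol p (j + p) r s = pol p j r s"
proof -
  assume "0 < p"
  then have "2 * pi * (s + real (j + p)) / real p = 2 * pi * (s + real j) / real p + 2 * pi"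
    by (simp add: field_simps)
  then show ?thesis by (simp add: pol_def flip: cis_mult)
qed

lemma pol_mod: "0 < p \<Longrightarrow> pol p (j mod p) r s = pol p j r s"
proof -
  assume p: "0 < p"
  have "pol p (i + k * p) r s = pol p i r s" for i k
  proof (induction k)
    case (Suc k)
    have "i + Suc k * p = (i + k * p) + p" by simp
    then show ?case using pol_add [OF p] Suc by metis
  qed simp
  from this [of "j mod p" "j div p"] show ?thesis by simp
qed

lemma ex_pol:
  assumes "0 < p"
  obtains j s where "j < p" "0 \<le> s" "s < 1" "w = pol p j (norm w) s"
proof -
  define y where "y = Arg2pi w * real p / (2 * pi)"
  have y: "0 \<le> y" "y < real p"
    using Arg2pi [of w] assms by (auto simp: y_def field_simps)
  show thesis
  proof (rule that [of "nat \<lfloor>y\<rfloor>" "frac y"])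
    show "nat \<lfloor>y\<rfloor> < p" using y by linarith
    have "frac y + real (nat \<lfloor>y\<rfloor>) = y" using y by (simp add: frac_def)
    moreover have "2 * pi * y / real p = Arg2pi w" using assms by (simp add: y_def)
    ultimately show "w = pol p (nat \<lfloor>y\<rfloor>) (norm w) (frac y)"
      unfolding pol_def cis_conv_exp using Arg2pi_eq [of w] by metis
  qed (auto simp: frac_lt_1)
qed

lemma Arg2pi_pol:
  assumes "0 < r" "j < p" "0 \<le> s" "s < 1"
  shows "Arg2pi (pol p j r s) * real p / (2 * pi) = s + real j"
proof -
  have "s + real j < real p" using assms by linarith
  then have "(s + real j) / real p < 1" using assms by simp
  then have "2 * pi * ((s + real j) / real p) < 2 * pi * 1" by (intro mult_strict_left_mono) auto
  then have "2 * pi * (s + real j) / real p < 2 * pi" by simp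
  then have "Arg2pi (pol p j r s) = 2 * pi * (s + real j) / real p"
    using assms by (intro Arg2pi_unique [of r]) (auto simp: pol_def cis_conv_exp)
  then show ?thesis using assms by simp
qed

text \<open>The pieces must agree wherever sector coordinates are ambiguous: for indices modulo
  \<open>p\<close>, on common walls, and at the origin. Compactness of the closed sectors then gives
  continuity.\<close>

lemma polar_glue:
  fixes g :: "nat \<Rightarrow> 'x::t2_space \<times> real \<times> real \<Rightarrow> 'b::topological_space"
  assumes p: "0 < p" and "compact A" and cont: "\<And>j. continuous_on (A \<times> {0..1} \<times> {0..1}) (g j)"
    and per: "\<And>j x r s. g (j + p) (x, r, s) = g j (x, r, s)"
    and wall: "\<And>j x r. x \<in> A \<Longrightarrow> r \<in> {0..1} \<Longrightarrow> g j (x, r, 1) = g (Suc j) (x, r, 0)"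
    and orig: "\<And>j x s. x \<in> A \<Longrightarrow> s \<in> {0..1} \<Longrightarrow> g j (x, 0, s) = g 0 (x, 0, 0)"
  shows "\<exists>f. continuous_on (A \<times> cball 0 1) f \<and>
    (\<forall>x\<in>A. \<forall>r\<in>{0..1}. \<forall>s\<in>{0..1}. \<forall>j. f (x, pol p j r s) = g j (x, r, s))"
proof -
  define f where "f = (\<lambda>(x, w). g (nat \<lfloor>Arg2pi w * real p / (2 * pi)\<rfloor>) (x, norm w, frac (Arg2pi w * real p / (2 * pi))))"
  have per': "g (j mod p) (x, r, s) = g j (x, r, s)" for j x r s
  proof -
    have "g (i + k * p) (x, r, s) = g i (x, r, s)" for i k
    proof (induction k)
      case (Suc k)
      have "i + Suc k * p = (i + k * p) + p" by simp
      then show ?case using per Suc by metis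
    qed simp
    from this [of "j mod p" "j div p"] show ?thesis by simp
  qed
  have f1: "f (x, pol p j r s) = g j (x, r, s)" if "x \<in> A" "r \<in> {0..1}" "0 \<le> s" "s < 1" for x j r s
  proof (cases "r = 0")
    case True
    \<comment> \<open>At the origin the sector and angle read off by \<open>f\<close> are arbitrary;
      \<open>orig\<close> makes the choice irrelevant.\<close>
    have "f (x, pol p j r s) = g 0 (x, 0, 0)"
      using orig [of x "frac (Arg2pi (pol p j r s) * real p / (2 * pi))"] that True
      by (simp add: f_def less_imp_le frac_lt_1)
    also have "\<dots> = g j (x, r, s)" using orig [of x s j] that True by simp
    finally show ?thesis .
  next
    case False
    define j' where "j' = j mod p"
    have "j' < p" using p by (simp add: j'_def)
    then have "Arg2pi (pol p j' r s) * real p / (2 * pi) = s + real j'"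
      using Arg2pi_pol that False by simp
    moreover have "\<lfloor>s + real j'\<rfloor> = int j'" using that by linarith
    ultimately have "f (x, pol p j' r s) = g j' (x, r, s)"
      using that by (simp add: f_def frac_def)
    then show ?thesis by (simp add: j'_def pol_mod [OF p] per')
  qed
  \<comment> \<open>\<open>Arg2pi\<close> always yields \<open>s < 1\<close>; the value
    \<open>s = 1\<close> is treated as \<open>s = 0\<close> in the next sector.\<close>
  have f: "f (x, pol p j r s) = g j (x, r, s)" if "x \<in> A" "r \<in> {0..1}" "s \<in> {0..1}" for x j r s
    using that f1 [of x r s j] f1 [of x r 0 "Suc j"] wall [of x r j]
    by (cases "s = 1") (auto simp: pol_one)
  define \<pi> where "\<pi> j = (\<lambda>(x::'x, r, s). (x, pol p j r s))" for j
  have "continuous_on (\<Union>j\<in>{..<p}. \<pi> j ` (A \<times> {0..1} \<times> {0..1})) f"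
  proof (rule continuous_on_finite_compact_cover)
    show "compact (A \<times> {0..1::real} \<times> {0..1::real})" using \<open>compact A\<close> by (intro compact_Times) auto
    show "continuous_on (A \<times> {0..1} \<times> {0..1}) (\<pi> j)" for j
      unfolding \<pi>_def pol_def case_prod_unfold by (intro continuous_intros) (use p in auto)
    show "continuous_on (A \<times> {0..1} \<times> {0..1}) (\<lambda>k. f (\<pi> j k))" for j
      by (rule continuous_on_eq [OF cont [of j]]) (auto simp: \<pi>_def f)
  qed simp
  moreover have "A \<times> cball 0 1 \<subseteq> (\<Union>j\<in>{..<p}. \<pi> j ` (A \<times> {0..1} \<times> {0..1}))"
  proof clarify
    fix x and w :: complex assume "x \<in> A" "w \<in> cball 0 1"
    obtain j s where js: "j < p" "0 \<le> s" "s < 1" "w = pol p j (norm w) s" using ex_pol [OF p] by blast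
    then have "(x, w) = \<pi> j (x, norm w, s)" by (simp add: \<pi>_def)
    then show "(x, w) \<in> (\<Union>j\<in>{..<p}. \<pi> j ` (A \<times> {0..1} \<times> {0..1}))"
      using js \<open>x \<in> A\<close> \<open>w \<in> cball 0 1\<close> by fastforce
  qed
  ultimately have "continuous_on (A \<times> cball 0 1) f" by (rule continuous_on_subset)
  with f show ?thesis by blast
qed

section \<open>Polydiscs and the actions of the two factors of the group\<close>

definition polydisc :: "nat \<Rightarrow> (nat \<Rightarrow> complex) set" where
  "polydisc n = {z. \<forall>i. if i < n then norm (z i) \<le> 1 else z i = 0}"

text \<open>Polydisc and boundary replace ball and sphere, so that adding a coordinate is taking the
  product with a disc. Padding with zeros keeps all dimensions in one type.\<close>

definition pbdry :: "nat \<Rightarrow> (nat \<Rightarrow> complex) set" where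
  "pbdry n = {z \<in> polydisc n. \<exists>i<n. norm (z i) = 1}"

definition act :: "(nat \<Rightarrow> nat) \<Rightarrow> complex \<Rightarrow> (nat \<Rightarrow> complex) \<Rightarrow> nat \<Rightarrow> complex" where
  "act a t z = (\<lambda>i. t ^ a i * z i)"

text \<open>The action on \<open>W\<close>: the generator of C_p acts by
  \<open>sig (zeta p)\<close>, an element \<open>t\<close> of the circle by
  \<open>tau (t ^ N)\<close>.\<close>

definition sig :: "complex \<Rightarrow> quat \<Rightarrow> quat" where "sig c x = (c * fst x, snd x)"
definition tau :: "complex \<Rightarrow> quat \<Rightarrow> quat" where "tau c x = (fst x, c * snd x)"

lemma compact_polydisc: "compact (polydisc n)"
proof -
  have "polydisc n = PiE UNIV (\<lambda>i. if i < n then cball 0 1 else {0})"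
    by (simp add: polydisc_def PiE_UNIV_domain Pi_def if_distrib [of "(\<in>) _"] cong: if_cong)
  then have "compactin (product_topology (\<lambda>i. euclidean) UNIV) (polydisc n)"
    by (auto simp: compactin_PiE)
  then show ?thesis by (simp add: euclidean_product_topology)
qed

lemma continuous_on_act [continuous_intros]:
  assumes "continuous_on X t" "continuous_on X z"
  shows "continuous_on X (\<lambda>x. act a (t x) (z x))"
  unfolding act_def
  by (intro continuous_on_coordinatewise_then_product continuous_intros assms
      continuous_on_product_then_coordinatewise [OF assms(2)])

lemma continuous_on_sig [continuous_intros]:
  "continuous_on X c \<Longrightarrow> continuous_on X f \<Longrightarrow> continuous_on X (\<lambda>x. sig (c x) (f x))"
  unfolding sig_def by (intro continuous_intros)

lemma continuous_on_tau [continuous_intros]: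
  "continuous_on X c \<Longrightarrow> continuous_on X f \<Longrightarrow> continuous_on X (\<lambda>x. tau (c x) (f x))"
  unfolding tau_def by (intro continuous_intros)

lemma act_polydisc [simp]: "norm t = 1 \<Longrightarrow> act a t z \<in> polydisc n \<longleftrightarrow> z \<in> polydisc n"
  and act_pbdry [simp]: "norm t = 1 \<Longrightarrow> act a t z \<in> pbdry n \<longleftrightarrow> z \<in> pbdry n"
  unfolding polydisc_def pbdry_def act_def by (auto simp: norm_mult norm_power split: if_splits)

lemma act_1 [simp]: "act a 1 z = z" by (simp add: act_def)
lemma act_mult: "act a (s * t) z = act a s (act a t z)" by (simp add: act_def power_mult_distrib mult_ac)
lemma act_commute: "act a s (act b t z) = act b t (act a s z)" by (simp add: act_def mult_ac)

lemma sig_S3 [simp]: "norm c = 1 \<Longrightarrow> x \<in> S3 \<Longrightarrow> sig c x \<in> S3"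
  and tau_S3 [simp]: "norm c = 1 \<Longrightarrow> x \<in> S3 \<Longrightarrow> tau c x \<in> S3"
  unfolding S3_iff sig_def tau_def by (simp_all add: norm_mult)

lemma sig_1 [simp]: "sig 1 x = x" and tau_1 [simp]: "tau 1 x = x"
  by (simp_all add: sig_def tau_def)

lemma sig_mult: "sig (c * d) x = sig c (sig d x)" and tau_mult: "tau (c * d) x = tau c (tau d x)"
  and sig_tau: "sig c (tau d x) = tau d (sig c x)"
  by (simp_all add: sig_def tau_def)

lemma sig_qone [simp]: "sig c qone = qone" by (simp add: sig_def)

lemma sig_qmul: "norm c = 1 \<Longrightarrow> sig c (qmul x y) = qmul (sig c x) (sig c y)"
  and sig_qinv: "sig c (qinv x) = qinv (sig c x)"
  using complex_norm_square [of c] by (auto simp: sig_def qmul_def qinv_def algebra_simps)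

lemma phi_sig: "norm c = 1 \<Longrightarrow> phi k (sig c x) = sig c (phi k x)"
  by (simp add: phi_def sig_def sgn_div_norm norm_Pair norm_mult norm_power scaleR_conv_of_real)

lemma phi_tau: "norm c = 1 \<Longrightarrow> phi k (tau c x) = tau (c ^ k) (phi k x)"
  by (simp add: phi_def tau_def sgn_div_norm norm_Pair norm_mult norm_power scaleR_conv_of_real power_mult_distrib)

text \<open>\<open>polar_glue\<close> with the time \<open>v\<close> absorbed into the parameter
  space, so that homotopies can be given sector by sector.\<close>

lemma homot_rel_polar:
  fixes g :: "nat \<Rightarrow> (real \<times> 'x::t2_space) \<times> real \<times> real \<Rightarrow> 'b::topological_space"
  assumes p: "0 < p" and "compact P" and "B \<subseteq> P"
    and cont: "\<And>j. continuous_on (({0..1} \<times> P) \<times> {0..1} \<times> {0..1}) (g j)"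
    and per: "\<And>j x r s. g (j + p) (x, r, s) = g j (x, r, s)"
    and wall: "\<And>j v z r. v \<in> {0..1} \<Longrightarrow> z \<in> P \<Longrightarrow> r \<in> {0..1} \<Longrightarrow> g j ((v, z), r, 1) = g (Suc j) ((v, z), r, 0)"
    and orig: "\<And>j v z s. v \<in> {0..1} \<Longrightarrow> z \<in> P \<Longrightarrow> s \<in> {0..1} \<Longrightarrow> g j ((v, z), 0, s) = g 0 ((v, z), 0, 0)"
    and Y: "\<And>j v z r s. v \<in> {0..1} \<Longrightarrow> z \<in> P \<Longrightarrow> r \<in> {0..1} \<Longrightarrow> s \<in> {0..1} \<Longrightarrow> g j ((v, z), r, s) \<in> Y"
    and bd: "\<And>j v z r s. v \<in> {0..1} \<Longrightarrow> z \<in> P \<Longrightarrow> r \<in> {0..1} \<Longrightarrow> s \<in> {0..1} \<Longrightarrow> z \<in> B \<or> r = 1 \<Longrightarrow>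
       g j ((v, z), r, s) = g j ((0, z), r, s)"
    and f0: "\<And>j z r s. z \<in> P \<Longrightarrow> r \<in> {0..1} \<Longrightarrow> s \<in> {0..1} \<Longrightarrow> f0 (z, pol p j r s) = g j ((0, z), r, s)"
    and f1: "\<And>j z r s. z \<in> P \<Longrightarrow> r \<in> {0..1} \<Longrightarrow> s \<in> {0..1} \<Longrightarrow> f1 (z, pol p j r s) = g j ((1, z), r, s)"
  shows "homot_rel (B \<times> cball 0 1 \<union> P \<times> sphere 0 1) (P \<times> cball 0 1) Y f0 f1"
proof -
  have cp: "compact ({0..1::real} \<times> P)" using \<open>compact P\<close> by (intro compact_Times) auto
  have wall': "g j (x, r, 1) = g (Suc j) (x, r, 0)" if "x \<in> {0..1} \<times> P" "r \<in> {0..1}" for j x r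
    using that wall by (cases x) blast
  have orig': "g j (x, 0, s) = g 0 (x, 0, 0)" if "x \<in> {0..1} \<times> P" "s \<in> {0..1}" for j x s
    using that orig by (cases x) blast
  obtain f where f: "continuous_on (({0..1} \<times> P) \<times> cball 0 1) f"
    and f': "\<forall>x\<in>{0..1} \<times> P. \<forall>r\<in>{0..1}. \<forall>s\<in>{0..1}. \<forall>j. f (x, pol p j r s) = g j (x, r, s)"
    using polar_glue [OF p cp, of g, OF cont per wall' orig'] by blast
  have polE: "\<exists>j s. 0 \<le> s \<and> s \<le> 1 \<and> w = pol p j (norm w) s" for w :: complex
    using ex_pol [OF p] less_imp_le by metis
  show ?thesis
  proof (rule homot_relI [where h = "\<lambda>(v, z, w). f ((v, z), w)"])
    show "continuous_on ({0..1} \<times> P \<times> cball 0 1) (\<lambda>(v, z, w). f ((v, z), w))"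
      unfolding case_prod_unfold
      by (rule continuous_on_compose2 [OF f]) (auto intro!: continuous_intros)
    fix x :: "'x \<times> complex"
    obtain z w where x: "x = (z, w)" by fastforce
    obtain j s where js: "0 \<le> s" "s \<le> 1" "w = pol p j (norm w) s" using polE by blast
    define r where "r = norm w"
    have w: "w = pol p j r s" using js r_def by simp
    have fv: "f ((v, z), w) = g j ((v, z), r, s)" if "v \<in> {0..1}" "x \<in> P \<times> cball 0 1" for v
      unfolding w using that js(1,2) x f' by (auto simp: r_def)
    have s: "s \<in> {0..1}" using js by simp
    have f0x: "f0 x = g j ((0, z), r, s)" if "z \<in> P" "r \<in> {0..1}"
      unfolding x by (subst w) (rule f0 [OF that s])
    have f1x: "f1 x = g j ((1, z), r, s)" if "z \<in> P" "r \<in> {0..1}"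
      unfolding x by (subst w) (rule f1 [OF that s])
    have xX: "z \<in> P" "r \<in> {0..1}" if "x \<in> P \<times> cball 0 1"
      using that by (auto simp: x r_def)
    show "(case (t, x) of (v, z, w) \<Rightarrow> f ((v, z), w)) \<in> Y" if "t \<in> {0..1}" "x \<in> P \<times> cball 0 1" for t
      using fv [OF that] Y [OF that(1) xX [OF that(2)] s] by (simp add: x)
    show "(case (0, x) of (v, z, w) \<Rightarrow> f ((v, z), w)) = f0 x" if "x \<in> P \<times> cball 0 1"
      using fv [OF _ that, of 0] f0x [OF xX [OF that]] by (simp add: x)
    show "(case (1, x) of (v, z, w) \<Rightarrow> f ((v, z), w)) = f1 x" if "x \<in> P \<times> cball 0 1"
      using fv [OF _ that, of 1] f1x [OF xX [OF that]] by (simp add: x)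
    show "(case (t, x) of (v, z, w) \<Rightarrow> f ((v, z), w)) = f0 x"
      if t: "t \<in> {0..1}" and xB: "x \<in> B \<times> cball 0 1 \<union> P \<times> sphere 0 1" for t
    proof -
      have xP: "x \<in> P \<times> cball 0 1" and zr: "z \<in> B \<or> r = 1"
        using xB \<open>B \<subseteq> P\<close> by (auto simp: x r_def)
      show ?thesis
        using fv [OF t xP] f0x [OF xX [OF xP]] bd [OF t xX [OF xP] s zr, of j] by (simp add: x)
    qed
  qed
qed

section \<open>Adding a coordinate\<close>

primrec qprod :: "(nat \<Rightarrow> quat) \<Rightarrow> nat \<Rightarrow> quat" where
  "qprod f 0 = qone"
| "qprod f (Suc k) = qmul (qprod f k) (f k)"

lemma qprod_const: "qprod (\<lambda>_. x) k = qpow k x"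
  by (induction k) simp_all

lemma qprod_qone: "(\<And>i. f i = qone) \<Longrightarrow> qprod f k = qone"
  by (induction k) simp_all

lemma qprod_S3: "(\<And>i. f i \<in> S3) \<Longrightarrow> qprod f k \<in> S3"
  by (induction k) simp_all

lemma qprod_telescope:
  assumes "\<And>i. K i \<in> S3" "\<And>i. f i = qmul (qinv (K i)) (K (Suc i))"
  shows "qprod f k = qmul (qinv (K 0)) (K k)"
  by (induction k) (simp_all add: assms qmul_assoc)

lemma continuous_on_qprod [continuous_intros]:
  "(\<And>i. continuous_on X (\<lambda>x. f x i)) \<Longrightarrow> continuous_on X (\<lambda>x. qprod (f x) k)"
  by (induction k) (auto intro!: continuous_intros)

abbreviation sc :: "complex \<Rightarrow> (nat \<Rightarrow> complex) \<Rightarrow> nat \<Rightarrow> complex" where "sc \<equiv> act (\<lambda>_. Suc 0)"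

definition zeta :: "nat \<Rightarrow> complex" where "zeta p = cis (2 * pi / real p)"

lemma zeta_pow: "zeta p ^ j = cis (2 * pi * real j / real p)"
  by (simp add: zeta_def Complex.DeMoivre mult_ac)

lemma norm_zeta [simp]: "norm (zeta p) = 1" "norm (zeta p ^ j) = 1" "norm (cnj (zeta p) ^ j) = 1"
  by (simp_all add: zeta_def norm_power)

lemma zeta_pow_p: "0 < p \<Longrightarrow> zeta p ^ p = 1"
  by (simp add: zeta_pow)

lemma pol_Suc: "pol p (Suc j) r s = zeta p * pol p j r s"
  by (simp add: pol_def zeta_def cis_mult add_divide_distrib algebra_simps)

lemma unit_cnj: "norm c = 1 \<Longrightarrow> c * cnj c = 1" "norm c = 1 \<Longrightarrow> cnj c * c = 1" for c :: complex
  using complex_norm_square [of c] by (simp_all add: mult.commute)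

text \<open>In a sector with radius \<open>r\<close> and angle \<open>s\<close>, both in [0, 1], the filling is the translate
  by the angle \<open>ang r s\<close> of the homotopy at time \<open>dep r s\<close>. On the circle \<open>r = 1/2\<close>, inside which
  no translation is applied, either the homotopy has reached \<open>T\<close> or the translation is
  trivial.\<close>

definition ramp :: "real \<Rightarrow> real" where "ramp s = max 0 (min 1 (3 * s - 1))"
definition ang :: "real \<Rightarrow> real \<Rightarrow> real" where "ang r s = (2 * r - 1) * s + (2 - 2 * r) * ramp s"
definition dep :: "real \<Rightarrow> real \<Rightarrow> real" where
  "dep r s = min (1 - \<bar>2 * r - 1\<bar>) (min 1 (min (3 * s) (3 - 3 * s)))"
text \<open>The depth used in \<open>T'\<close>: it is 1, where the homotopy is at \<open>T\<close>,
  on the inner disc, and falls to 0, where it is at \<open>F\<close>, on the rim.\<close>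

definition col :: "real \<Rightarrow> real" where "col r = min 1 (2 - 2 * r)"

lemma dep_range: "r \<in> {0..1} \<Longrightarrow> s \<in> {0..1} \<Longrightarrow> dep r s \<in> {0..1}"
  and col_range: "r \<in> {0..1} \<Longrightarrow> col r \<in> {0..1}"
  by (auto simp: dep_def col_def)

lemma ang_dep_simps:
  "ang r 0 = 0" "ang r 1 = 1" "ang 1 s = s" "r \<in> {0..1} \<Longrightarrow> dep r 0 = 0" "r \<in> {0..1} \<Longrightarrow> dep r 1 = 0"
  "s \<in> {0..1} \<Longrightarrow> dep 0 s = 0" "s \<in> {0..1} \<Longrightarrow> dep 1 s = 0" "col 1 = 0" "r \<le> 1/2 \<Longrightarrow> col r = 1"
  by (auto simp: ang_def dep_def ramp_def col_def)

text \<open>At radius 1/2 the angle is \<open>ramp s\<close>, which is 0 on the first third and 1 on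
  the last, and the depth is 1 on the middle third.\<close>

lemma ang_dep_half: "dep (1/2) s = 1 \<or> ang (1/2) s = 0 \<or> ang (1/2) s = 1"
  by (auto simp: ang_def dep_def ramp_def)

lemma continuous_on_ang [continuous_intros]:
  "continuous_on X f \<Longrightarrow> continuous_on X g \<Longrightarrow> continuous_on X (\<lambda>x. ang (f x) (g x))"
  and continuous_on_dep [continuous_intros]:
  "continuous_on X f \<Longrightarrow> continuous_on X g \<Longrightarrow> continuous_on X (\<lambda>x. dep (f x) (g x))"
  and continuous_on_col [continuous_intros]:
  "continuous_on X f \<Longrightarrow> continuous_on X (\<lambda>x. col (f x))"
  unfolding ang_def dep_def ramp_def col_def by (intro continuous_intros; assumption)+

section \<open>The inductive step from \<open>n\<close> to \<open>n + 1\<close> coordinates\<close>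

lemma pbdry_subset: "pbdry n \<subseteq> polydisc n" by (auto simp: pbdry_def)

locale extension_step =
  fixes p n N :: nat and a :: "nat \<Rightarrow> nat" and F T :: "(nat \<Rightarrow> complex) \<Rightarrow> quat"
    and Q :: "real \<times> (nat \<Rightarrow> complex) \<Rightarrow> quat"
  assumes p: "0 < p"
    and Q_cont: "continuous_on ({0..1} \<times> polydisc n) Q"
    and Q_S3: "\<And>u z. u \<in> {0..1} \<Longrightarrow> z \<in> polydisc n \<Longrightarrow> Q (u, z) \<in> S3"
    and Q_0: "\<And>z. z \<in> polydisc n \<Longrightarrow> Q (0, z) = F z"
    and Q_1: "\<And>z. z \<in> polydisc n \<Longrightarrow> Q (1, z) = T z"
    and Q_bdry: "\<And>u z. u \<in> {0..1} \<Longrightarrow> z \<in> pbdry n \<Longrightarrow> Q (u, z) = F z"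
    and F_equiv: "\<And>z. z \<in> polydisc n \<Longrightarrow> F (sc (zeta p) z) = sig (zeta p) (F z)"
    and T_equiv: "\<And>t z. norm t = 1 \<Longrightarrow> z \<in> polydisc n \<Longrightarrow> T (act a t z) = tau (t ^ N) (T z)"
begin

text \<open>The translate of \<open>Q (u, _)\<close> by a unit \<open>c\<close>, whose inverse is
  \<open>cnj c\<close>: the inverse acts on the source and \<open>c\<close> on the target.\<close>

definition rot :: "complex \<Rightarrow> real \<Rightarrow> (nat \<Rightarrow> complex) \<Rightarrow> quat" where
  "rot c u z = tau (c ^ N) (Q (u, act a (cnj c) z))"

lemma rot_1 [simp]: "rot 1 u z = Q (u, z)" by (simp add: rot_def)

lemma rot_S3: "norm c = 1 \<Longrightarrow> u \<in> {0..1} \<Longrightarrow> z \<in> polydisc n \<Longrightarrow> rot c u z \<in> S3"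
  by (auto simp: rot_def norm_power intro!: tau_S3 Q_S3)

lemma tau_T: 
  assumes "norm c = 1" "z \<in> polydisc n"
  shows "tau (c ^ N) (T (act a (cnj c) z)) = T z"
proof -
  have "tau (c ^ N) (T (act a (cnj c) z)) = T (act a c (act a (cnj c) z))"
    using assms by (subst T_equiv) auto
  also have "\<dots> = T z" using assms by (simp add: unit_cnj flip: act_mult)
  finally show ?thesis .
qed

lemma rot_T: "norm c = 1 \<Longrightarrow> z \<in> polydisc n \<Longrightarrow> rot c 1 z = T z"
  by (simp add: rot_def Q_1 tau_T)

text \<open>On the boundary \<open>Q\<close> is independent of the time, which may thus be set to 1,
  where all translates coincide.\<close>

lemma rot_bdry:
  assumes "norm c = 1" "u \<in> {0..1}" "z \<in> pbdry n" shows "rot c u z = F z"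
proof -
  have z: "z \<in> polydisc n" using assms pbdry_subset by blast
  have "rot c u z = rot c 1 z" using assms by (simp add: rot_def Q_bdry)
  also have "\<dots> = Q (1, z)" using assms z by (simp add: rot_T Q_1)
  also have "\<dots> = F z" using assms by (simp add: Q_bdry)
  finally show ?thesis .
qed

lemma F_equiv_pow: "z \<in> polydisc n \<Longrightarrow> F (sc (zeta p ^ j) z) = sig (zeta p ^ j) (F z)"
  by (induction j) (simp_all add: act_mult sig_mult F_equiv)

text \<open>The actions of the circle and of C_p commute on source and target, so circle translates
  of \<open>F\<close> remain C_p-equivariant.\<close>

lemma rot_F:
  assumes "norm c = 1" "z \<in> polydisc n"
  shows "sig (zeta p ^ j) (rot c 0 (sc (cnj (zeta p ^ j)) z)) = rot c 0 z"
proof -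
  let ?y = "act a (cnj c) (sc (cnj (zeta p ^ j)) z)"
  have y: "?y \<in> polydisc n" using assms by simp
  have "sig (zeta p ^ j) (rot c 0 (sc (cnj (zeta p ^ j)) z)) = tau (c ^ N) (sig (zeta p ^ j) (F ?y))"
    unfolding rot_def using y by (simp only: sig_tau Q_0)
  also have "\<dots> = tau (c ^ N) (F (sc (zeta p ^ j) ?y))" using y by (simp only: F_equiv_pow)
  also have "sc (zeta p ^ j) ?y = act a (cnj c) z"
    by (subst act_commute) (simp add: unit_cnj del: complex_cnj_power flip: act_mult)
  finally show ?thesis using assms by (simp add: rot_def Q_0)
qed

lemma F_invariant: "z \<in> polydisc n \<Longrightarrow> sig (zeta p ^ j) (F (sc (cnj (zeta p ^ j)) z)) = F z"
  using rot_F [of 1 z j] by (simp add: Q_0)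

definition Gam :: "real \<Rightarrow> real \<Rightarrow> real \<Rightarrow> (nat \<Rightarrow> complex) \<Rightarrow> quat" where
  "Gam \<theta> u r z = (if r \<le> 1/2 then Q (u, z) else rot (cis (2 * pi * \<theta>)) u z)"

lemma Gam_S3: "u \<in> {0..1} \<Longrightarrow> z \<in> polydisc n \<Longrightarrow> Gam \<theta> u r z \<in> S3"
  by (simp add: Gam_def Q_S3 rot_S3)

lemma Gam_bdry: "u \<in> {0..1} \<Longrightarrow> z \<in> pbdry n \<Longrightarrow> Gam \<theta> u r z = F z"
  by (simp add: Gam_def Q_bdry rot_bdry)

lemma Gam_full: "\<theta> = 0 \<or> \<theta> = 1 \<Longrightarrow> Gam \<theta> u r z = Q (u, z)"
  by (auto simp: Gam_def)

text \<open>The branches of \<open>Gam\<close> agree at radius 1/2: for \<open>u = 1\<close> because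
  \<open>T\<close> is invariant under translation, otherwise because the translation is by 0 or 1
  full turns.\<close>

lemma continuous_on_Gam:
  assumes "continuous_on X \<theta>" "continuous_on X u" "continuous_on X r" "continuous_on X z"
    and uz: "\<And>x. x \<in> X \<Longrightarrow> u x \<in> {0..1}" "\<And>x. x \<in> X \<Longrightarrow> z x \<in> polydisc n"
    and half: "\<And>x. x \<in> X \<Longrightarrow> r x = 1/2 \<Longrightarrow> u x = 1 \<or> \<theta> x = 0 \<or> \<theta> x = 1"
  shows "continuous_on X (\<lambda>x. Gam (\<theta> x) (u x) (r x) (z x))"
proof -
  have c1: "continuous_on X (\<lambda>x. Q (u x, z x))"
    by (rule continuous_on_compose2 [OF Q_cont]) (use uz in \<open>auto intro!: continuous_intros assms\<close>)
  have "continuous_on X (\<lambda>x. act a (cnj (cis (2 * pi * \<theta> x))) (z x))"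
    by (rule continuous_on_act) (intro continuous_intros assms)+
  then have "continuous_on X (\<lambda>x. Q (u x, act a (cnj (cis (2 * pi * \<theta> x))) (z x)))"
    by (intro continuous_on_compose2 [OF Q_cont] continuous_on_Pair assms) (use uz in auto)
  then have c2: "continuous_on X (\<lambda>x. rot (cis (2 * pi * \<theta> x)) (u x) (z x))"
    unfolding rot_def by (intro continuous_intros assms)
  have "Q (u x, z x) = rot (cis (2 * pi * \<theta> x)) (u x) (z x)" if "x \<in> X" "r x = 1/2" for x
    using half [OF that] uz [OF that(1)] by (auto simp: rot_T Q_1)
  then show ?thesis unfolding Gam_def
    by (intro continuous_on_cases_le assms continuous_on_subset [OF c1] continuous_on_subset [OF c2]) auto
qed

definition H :: "(nat \<Rightarrow> complex) \<Rightarrow> real \<Rightarrow> real \<Rightarrow> quat" where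
  "H z r s = Gam (ang r s) (dep r s) r z"

lemma H_S3: "z \<in> polydisc n \<Longrightarrow> r \<in> {0..1} \<Longrightarrow> s \<in> {0..1} \<Longrightarrow> H z r s \<in> S3"
  unfolding H_def by (intro Gam_S3 dep_range)

text \<open>On both walls and at the centre the depth is 0 and no translation is left. Along the arc
  the angle makes a full turn, so a single sector carries the whole loop of translates.\<close>

lemma H_walls:
  assumes "z \<in> polydisc n" "r \<in> {0..1}" "s \<in> {0..1}"
  shows "H z r 0 = F z" "H z r 1 = F z" "H z 0 s = F z" "H z 1 s = rot (cis (2 * pi * s)) 0 z"
    "z \<in> pbdry n \<Longrightarrow> H z r s = F z"
  using assms dep_range [OF assms(2,3)]
  by (simp_all add: H_def ang_dep_simps Gam_full Q_0 Gam_bdry) (simp_all add: Gam_def Q_0)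

lemma continuous_on_H:
  assumes "continuous_on X r" "continuous_on X s" "continuous_on X z"
    and "\<And>x. x \<in> X \<Longrightarrow> r x \<in> {0..1}" "\<And>x. x \<in> X \<Longrightarrow> s x \<in> {0..1}" "\<And>x. x \<in> X \<Longrightarrow> z x \<in> polydisc n"
  shows "continuous_on X (\<lambda>x. H (z x) (r x) (s x))"
  unfolding H_def
proof (rule continuous_on_Gam)
  show "dep (r x) (s x) = 1 \<or> ang (r x) (s x) = 0 \<or> ang (r x) (s x) = 1" if "r x = 1/2" for x
    unfolding that by (rule ang_dep_half)
qed (use assms in \<open>auto intro!: continuous_intros dep_range [simplified]\<close>)

section \<open>The two extensions over the larger polydisc and their comparison\<close>

abbreviation "X \<equiv> polydisc n \<times> cball (0::complex) 1"
abbreviation "B \<equiv> pbdry n \<times> cball (0::complex) 1 \<union> polydisc n \<times> sphere (0::complex) 1"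

lemma BX: "B \<subseteq> X" using pbdry_subset by auto

lemma polE:
  assumes "(z, w) \<in> X"
  obtains j r s where "z \<in> polydisc n" "r \<in> {0..1}" "s \<in> {0..1}" "w = pol p j r s" "norm w = r"
  using assms ex_pol [OF p, of w] by (metis atLeastAtMost_iff less_imp_le mem_Sigma_iff mem_cball_0 norm_ge_zero)

text \<open>The case distinction avoids \<open>sgn 0 = 0\<close>; on the inner disc the second branch would be
  \<open>T z\<close> as well.\<close>

definition T' :: "(nat \<Rightarrow> complex) \<times> complex \<Rightarrow> quat" where
  "T' = (\<lambda>(z, w). if norm w \<le> 1/2 then T z else rot (sgn w ^ p) (col (norm w)) z)"

text \<open>The \<open>p\<close>-th power turns the passage across one sector into a full turn,
  which removes the dependence on \<open>j\<close>.\<close>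

lemma T'_pol:
  assumes "z \<in> polydisc n" "r \<in> {0..1}" "s \<in> {0..1}"
  shows "T' (z, pol p j r s) = Gam s (col r) r z"
proof (cases "r \<le> 1/2")
  case True
  then show ?thesis using assms by (simp add: T'_def Gam_def ang_dep_simps Q_1)
next
  case False
  have "sgn (pol p j r s) ^ p = cis (2 * pi * (s + real j))"
    using False p by (simp add: pol_def sgn_mult sgn_of_real Complex.DeMoivre)
  also have "\<dots> = cis (2 * pi * s)"
    by (simp add: distrib_left flip: cis_mult)
  finally show ?thesis using False assms by (simp add: T'_def Gam_def)
qed

text \<open>Moving \<open>w\<close> by \<open>t\<close> multiplies the translation parameter by
  \<open>t ^ p\<close>. On the source this cancels the action of \<open>t ^ p\<close> on
  \<open>z\<close>; on the target it leaves the factor \<open>t ^ (p * N)\<close>.\<close>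

lemma T'_equiv:
  assumes "norm t = 1" "(z, w) \<in> X"
  shows "T' (act a (t ^ p) z, t * w) = tau (t ^ (p * N)) (T' (z, w))"
proof (cases "norm w \<le> 1/2")
  case True
  then show ?thesis using assms by (simp add: T'_def norm_mult T_equiv norm_power power_mult)
next
  case False
  have *: "act a (cnj ((t * sgn w) ^ p)) (act a (t ^ p) z) = act a (cnj (sgn w ^ p)) z"
  proof -
    have "cnj ((t * sgn w) ^ p) * t ^ p = cnj (sgn w ^ p) * (cnj t * t) ^ p"
      by (simp add: power_mult_distrib)
    also have "\<dots> = cnj (sgn w ^ p)" using assms by (simp add: unit_cnj)
    finally show ?thesis by (simp only: act_mult [symmetric])
  qed
  have "sgn (t * w) = t * sgn w" using assms by (simp add: sgn_mult) (simp add: sgn_div_norm)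
  then have "T' (act a (t ^ p) z, t * w) = tau (((t * sgn w) ^ p) ^ N) (Q (col (norm w), act a (cnj (sgn w ^ p)) z))"
    using False assms by (simp only: T'_def case_prod_conv norm_mult rot_def *) simp
  also have "\<dots> = tau (t ^ (p * N)) (T' (z, w))"
    using False by (simp add: T'_def rot_def power_mult_distrib tau_mult power_mult)
  finally show ?thesis .
qed

lemma X_cases:
  assumes "x \<in> X"
  obtains z j r s where "x = (z, pol p j r s)" "z \<in> polydisc n" "r \<in> {0..1}" "s \<in> {0..1}" "norm (snd x) = r"
  using assms polE [of "fst x" "snd x"] by (metis prod.collapse)

text \<open>First the rotation angle is straightened near the walls of the sectors, which is
  harmless as long as the depth there equals 1; then the depth is lowered to 0 on the walls.\<close>

lemma homot_T'_H:
  assumes "\<And>z r s j. z \<in> polydisc n \<Longrightarrow> r \<in> {0..1} \<Longrightarrow> s \<in> {0..1} \<Longrightarrow> Hh (z, pol p j r s) = H z r s"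
  shows "homot_rel B X S3 T' Hh"
proof -
  define M1 where "M1 = (\<lambda>((v, z), r, s). Gam ((1 - v) * s + v * ang r s) (col r) r z)"
  define M2 where "M2 = (\<lambda>((v, z), r, s). Gam (ang r s) ((1 - v) * col r + v * dep r s) r z)"
  let ?D = "({0..1} \<times> polydisc n) \<times> {0..1} \<times> {0..1}"
  have mix: "(1 - v) * col r + v * dep r s \<in> {0..1}" if "v \<in> {0..1}" "r \<in> {0..1}" "s \<in> {0..1}" for v r s
  proof -
    have "convex {0..1::real}" by simp
    from convexD [OF this col_range [OF that(2)] dep_range [OF that(2,3)], of "1 - v" v] that(1)
    show ?thesis by simp
  qed
  have c1: "continuous_on ?D M1" unfolding M1_def case_prod_unfold
  proof (rule continuous_on_Gam)
    show "col (fst (snd x)) = 1 \<or> (1 - fst (fst x)) * snd (snd x) + fst (fst x) * ang (fst (snd x)) (snd (snd x)) = 0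
        \<or> (1 - fst (fst x)) * snd (snd x) + fst (fst x) * ang (fst (snd x)) (snd (snd x)) = 1" 
      if "fst (snd x) = 1/2" for x :: "(real \<times> (nat \<Rightarrow> complex)) \<times> real \<times> real"
      using that by (simp add: ang_dep_simps)
  qed (rule col_range | (intro continuous_intros; fail) | force)+
  have c2: "continuous_on ?D M2" unfolding M2_def case_prod_unfold
  proof (rule continuous_on_Gam)
    show "(1 - fst (fst x)) * col (fst (snd x)) + fst (fst x) * dep (fst (snd x)) (snd (snd x)) = 1 \<or> ang (fst (snd x)) (snd (snd x)) = 0
        \<or> ang (fst (snd x)) (snd (snd x)) = 1" 
      if "fst (snd x) = 1/2" for x :: "(real \<times> (nat \<Rightarrow> complex)) \<times> real \<times> real"
      using ang_dep_half [of "snd (snd x)"] unfolding that by (auto simp: ang_dep_simps)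
    show "(1 - fst (fst x)) * col (fst (snd x)) + fst (fst x) * dep (fst (snd x)) (snd (snd x)) \<in> {0..1}" if "x \<in> ?D" for x
      using that by (intro mix) auto
  qed ((intro continuous_intros; fail) | force)+
  have g1: "M1 ((v, z), r, 1) = M1 ((v, z), r, 0)" "M1 ((v, z), 0, s) = T z"
    "M1 ((v, z), r, s) \<in> S3" "z \<in> pbdry n \<or> r = 1 \<Longrightarrow> M1 ((v, z), r, s) = M1 ((0, z), r, s)"
    if "v \<in> {0..1}" "z \<in> polydisc n" "r \<in> {0..1}" "s \<in> {0..1}" for v z r s
    using that col_range [OF that(3)]
    by (auto simp: M1_def ang_dep_simps Gam_full Gam_S3 Gam_bdry intro: Gam_S3) (auto simp: Gam_def ang_dep_simps Q_1 algebra_simps)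
  have g2: "M2 ((v, z), r, 1) = M2 ((v, z), r, 0)" "M2 ((v, z), 0, s) = Q (1 - v, z)"
    "M2 ((v, z), r, s) \<in> S3" "z \<in> pbdry n \<or> r = 1 \<Longrightarrow> M2 ((v, z), r, s) = M2 ((0, z), r, s)"
    if "v \<in> {0..1}" "z \<in> polydisc n" "r \<in> {0..1}" "s \<in> {0..1}" for v z r s
    using that mix [OF that(1,3,4)] mix [OF _ that(3,4), of 0]
    by (auto simp: M2_def ang_dep_simps Gam_full Gam_S3 Gam_bdry intro: Gam_S3) (auto simp: Gam_def ang_dep_simps)
  \<comment> \<open>\<open>K\<close> is the map between the two stages, with angle
    \<open>ang r s\<close> and depth still \<open>col r\<close>.\<close>
  have "\<exists>f. continuous_on X f \<and> (\<forall>z\<in>polydisc n. \<forall>r\<in>{0..1}. \<forall>s\<in>{0..1}. \<forall>j.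
      f (z, pol p j r s) = (\<lambda>(z, r, s). M1 ((1, z), r, s)) (z, r, s))"
  proof (rule polar_glue [where g = "\<lambda>_ (z, r, s). M1 ((1, z), r, s)", OF p compact_polydisc])
    show "continuous_on (polydisc n \<times> {0..1} \<times> {0..1}) (\<lambda>(z, r, s). M1 ((1, z), r, s))"
      unfolding case_prod_unfold by (rule continuous_on_compose2 [OF c1]) (auto intro!: continuous_intros)
  qed (use g1 [of 1] in auto)
  then obtain K where "\<forall>z\<in>polydisc n. \<forall>r\<in>{0..1}. \<forall>s\<in>{0..1}. \<forall>j. K (z, pol p j r s) = M1 ((1, z), r, s)"
    by auto
  then have K: "K (z, pol p j r s) = M1 ((1, z), r, s)"
    if "z \<in> polydisc n" "r \<in> {0..1}" "s \<in> {0..1}" for z r s j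
    using that by blast
  have "homot_rel B X S3 T' K"
  proof (rule homot_rel_polar [where g = "\<lambda>_. M1", OF p compact_polydisc pbdry_subset c1])
    show "T' (z, pol p j r s) = M1 ((0, z), r, s)" if "z \<in> polydisc n" "r \<in> {0..1}" "s \<in> {0..1}" for z r s j
      using that by (simp add: T'_pol M1_def)
  qed (rule refl | rule K g1; assumption? | subst g1; simp)+
  moreover have "homot_rel B X S3 K Hh"
  proof (rule homot_rel_polar [where g = "\<lambda>_. M2", OF p compact_polydisc pbdry_subset c2])
    show "K (z, pol p j r s) = M2 ((0, z), r, s)" if "z \<in> polydisc n" "r \<in> {0..1}" "s \<in> {0..1}" for z r s j
      using that by (simp add: K M1_def M2_def)
    show "Hh (z, pol p j r s) = M2 ((1, z), r, s)" if "z \<in> polydisc n" "r \<in> {0..1}" "s \<in> {0..1}" for z r s j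
      using that by (simp add: assms M2_def H_def)
  qed (rule refl | rule g2; assumption? | subst g2; simp)+
  ultimately show ?thesis by (rule homot_rel_trans [OF _ _ BX])
qed

text \<open>As \<open>H\<close> is \<open>F\<close> on every wall, equal copies of it on all sectors
  fit together. This untranslated filling links the two extensions.\<close>

lemma H_glues:
  "\<exists>Hh. continuous_on X Hh \<and> (\<forall>z\<in>polydisc n. \<forall>r\<in>{0..1}. \<forall>s\<in>{0..1}. \<forall>j. Hh (z, pol p j r s) = H z r s)"
proof -
  have "continuous_on (polydisc n \<times> {0..1} \<times> {0..1}) (\<lambda>(z, r, s). H z r s)"
    unfolding case_prod_unfold by (rule continuous_on_H) (auto intro!: continuous_intros)
  from polar_glue [OF p compact_polydisc this] show ?thesis
    by (simp add: H_walls)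
qed

text \<open>Neighbouring pieces are different translates, but they meet in values of
  \<open>F\<close>, which is C_p-equivariant.\<close>

lemma translated_H_glues:
  "\<exists>F'. continuous_on X F' \<and> (\<forall>z\<in>polydisc n. \<forall>r\<in>{0..1}. \<forall>s\<in>{0..1}. \<forall>j.
     F' (z, pol p j r s) = sig (zeta p ^ j) (H (sc (cnj (zeta p ^ j)) z) r s))"
proof -
  let ?g = "\<lambda>j (z, r, s). sig (zeta p ^ j) (H (sc (cnj (zeta p ^ j)) z) r s)"
  have c: "continuous_on (polydisc n \<times> {0..1} \<times> {0..1}) (?g j)" for j
    unfolding case_prod_unfold
    by (intro continuous_on_sig continuous_on_H continuous_on_act) (auto intro!: continuous_intros)
  have "\<exists>f. continuous_on X f \<and> (\<forall>x\<in>polydisc n. \<forall>r\<in>{0..1}. \<forall>s\<in>{0..1}. \<forall>j. f (x, pol p j r s) = ?g j (x, r, s))"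
  proof (rule polar_glue [OF p compact_polydisc c])
    show "?g (j + p) (x, r, s) = ?g j (x, r, s)" for j x r s
      by (simp add: power_add zeta_pow_p [OF p])
    show "?g j (x, r, 1) = ?g (Suc j) (x, r, 0)" if "x \<in> polydisc n" "r \<in> {0..1}" for j x r
      using that F_invariant [of x j] F_invariant [of x "Suc j"] by (simp add: H_walls norm_mult)
    show "?g j (x, 0, s) = ?g 0 (x, 0, 0)" if "x \<in> polydisc n" "s \<in> {0..1}" for j x s
      using that F_invariant [of x j] by (simp add: H_walls)
  qed
  then show ?thesis by simp
qed

text \<open>\<open>E\<close> is the quotient of \<open>F'\<close> by \<open>Hh\<close>. By
  \<open>homot_rel_twist\<close> the quotient of \<open>phi p (F' x)\<close> by
  \<open>phi p (Hh x)\<close> deforms to \<open>qpow p (E x)\<close>, which is contracted to 1;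
  multiplying back by \<open>phi p (Hh x)\<close> finishes.\<close>

lemma homot_phi_F'_H:
  assumes Hh: "continuous_on X Hh" "\<And>z r s j. z \<in> polydisc n \<Longrightarrow> r \<in> {0..1} \<Longrightarrow> s \<in> {0..1} \<Longrightarrow> Hh (z, pol p j r s) = H z r s"
    and F': "continuous_on X F'" "\<And>z r s j. z \<in> polydisc n \<Longrightarrow> r \<in> {0..1} \<Longrightarrow> s \<in> {0..1} \<Longrightarrow>
      F' (z, pol p j r s) = sig (zeta p ^ j) (H (sc (cnj (zeta p ^ j)) z) r s)"
  shows "homot_rel B X S3 (\<lambda>x. phi p (F' x)) (\<lambda>x. phi p (Hh x))"
proof -
  have HhS: "Hh x \<in> S3" if "x \<in> X" for x
    by (rule X_cases [OF that]) (simp add: Hh(2) H_S3)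
  have F'S: "F' x \<in> S3" if "x \<in> X" for x
    by (rule X_cases [OF that]) (simp add: F'(2) H_S3)
  define E where "E x = qmul (qinv (Hh x)) (F' x)" for x
  have E: "continuous_on X E" unfolding E_def by (intro continuous_intros Hh(1) F'(1))
  have ES: "E x \<in> S3" if "x \<in> X" for x using HhS F'S that by (simp add: E_def)
  have E_pol: "E (z, pol p j r s) = qmul (qinv (H z r s)) (sig (zeta p ^ j) (H (sc (cnj (zeta p ^ j)) z) r s))"
    if "z \<in> polydisc n" "r \<in> {0..1}" "s \<in> {0..1}" for z r s j
    using that by (simp add: E_def Hh(2) F'(2))
  have E1: "E (z, pol p j r s) = qone"
    if "z \<in> polydisc n" "r \<in> {0..1}" "s \<in> {0..1}" "r = 0 \<or> r = 1 \<or> s = 0 \<or> s = 1 \<or> z \<in> pbdry n" for z r s j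
  proof -
    \<comment> \<open>Here \<open>H\<close> takes values of \<open>F\<close> or of circle translates
      of \<open>F\<close>, which C_p leaves invariant.\<close>
    have "sig (zeta p ^ j) (H (sc (cnj (zeta p ^ j)) z) r s) = H z r s"
      using that F_invariant [of z j] rot_F [of "cis (2 * pi * s)" z j] by (auto simp: H_walls)
    then show ?thesis using that by (simp add: E_pol H_S3)
  qed
  have E_B: "E x = qone" if "x \<in> B" for x
  proof -
    have "x \<in> X" using that BX by blast
    then obtain z j r s where x: "x = (z, pol p j r s)" "z \<in> polydisc n" "r \<in> {0..1}" "s \<in> {0..1}" "norm (snd x) = r"
      by (rule X_cases)
    then have "r = 1 \<or> z \<in> pbdry n" using that by auto
    then show ?thesis unfolding x(1) using x E1 [of z r s j] by blast
  qed
  \<comment> \<open>Rotating only the \<open>z\<close>-coordinate moves every translate of \<open>E\<close> to \<open>E\<close> within one sector;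
    at the end of the rotation the product telescopes.\<close>
  define th where "th i j = 2 * pi * real (j mod p) * real i / real p" for i j
  define g where "g j = (\<lambda>((v, z), r, s). qprod (\<lambda>i. sig (cis (v * th i j)) (E (sc (cis (- (v * th i j))) z, pol p j r s))) p)" for j
  have "homot_rel B X S3 (\<lambda>x. qpow p (E x)) (\<lambda>x. qone)"
  proof (rule homot_rel_polar [where g = g, OF p compact_polydisc pbdry_subset])
    show "continuous_on (({0..1} \<times> polydisc n) \<times> {0..1} \<times> {0..1}) (g j)" for j
    proof -
      have "continuous_on (({0..1} \<times> polydisc n) \<times> {0..1} \<times> {0..1})
         (\<lambda>x. E (sc (cis (- (fst (fst x) * th i j))) (snd (fst x)), pol p j (fst (snd x)) (snd (snd x))))" for i
        unfolding pol_def
        by (intro continuous_on_compose2 [OF E] continuous_on_Pair continuous_on_act)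
           (use p in \<open>auto intro!: continuous_intros simp: norm_mult\<close>)
      then show ?thesis unfolding g_def case_prod_unfold by (intro continuous_intros)
    qed
    show "g (j + p) (x, r, s) = g j (x, r, s)" for j x r s
      by (simp add: g_def th_def pol_add [OF p])
    \<comment> \<open>The angle \<open>th i j\<close> jumps from sector to sector, but on the walls
      every factor of the product is 1.\<close>
    show "g j ((v, z), r, 1) = g (Suc j) ((v, z), r, 0)"
      if "v \<in> {0..1}" "z \<in> polydisc n" "r \<in> {0..1}" for j v z r
      using that by (simp add: g_def E1 qprod_qone)
    show "g j ((v, z), 0, s) = g 0 ((v, z), 0, 0)"
      if "v \<in> {0..1}" "z \<in> polydisc n" "s \<in> {0..1}" for j v z s
      using that by (simp add: g_def E1 qprod_qone)
    show "g j ((v, z), r, s) \<in> S3"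
      if "v \<in> {0..1}" "z \<in> polydisc n" "r \<in> {0..1}" "s \<in> {0..1}" for j v z r s
      using that by (auto simp: g_def intro!: qprod_S3 sig_S3 ES)
    show "g j ((v, z), r, s) = g j ((0, z), r, s)"
      if "v \<in> {0..1}" "z \<in> polydisc n" "r \<in> {0..1}" "s \<in> {0..1}" "z \<in> pbdry n \<or> r = 1" for j v z r s
      using that by (auto simp: g_def E1 qprod_qone)
    show "qpow p (E (z, pol p j r s)) = g j ((0, z), r, s)" for j z r s
      by (simp add: g_def qprod_const)
    show "qone = g j ((1, z), r, s)" if "z \<in> polydisc n" "r \<in> {0..1}" "s \<in> {0..1}" for j z r s
    proof -
      define c where "c = zeta p ^ (j mod p)"
      have c: "norm c = 1" by (simp add: c_def)
      have cp: "c ^ p = 1" unfolding c_def by (metis zeta_pow_p [OF p] power_mult mult.commute power_one)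
      have cj: "zeta p ^ j = c"
        unfolding c_def by (metis zeta_pow_p [OF p] mod_mult_div_eq mult_1_right power_add power_mult power_one)
      have cis: "cis (th i j) = c ^ i" "cis (- th i j) = cnj (c ^ i)" for i
        by (simp_all add: c_def th_def zeta_pow Complex.DeMoivre mult_ac flip: cis_cnj)
      \<comment> \<open>\<open>K i\<close> is the translate of \<open>H\<close> by
        \<open>c ^ i\<close>. Translating the quotient \<open>E\<close> by \<open>c ^ i\<close>
        turns it into the quotient of \<open>K (Suc i)\<close> by \<open>K i\<close>.\<close>
      define K where "K i = sig (c ^ i) (H (sc (cnj (c ^ i)) z) r s)" for i
      have KS: "K i \<in> S3" for i
        unfolding K_def using that c by (intro sig_S3 H_S3) (auto simp: norm_power)
      have "g j ((1, z), r, s) = qprod (\<lambda>i. qmul (qinv (K i)) (K (Suc i))) p"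
      proof -
        have "sig (c ^ i) (E (sc (cnj (c ^ i)) z, pol p j r s)) = qmul (qinv (K i)) (K (Suc i))" for i
          using that c
          by (subst E_pol) (auto simp: norm_power cj K_def sig_qmul sig_qinv mult.commute sig_mult act_mult simp flip: act_mult sig_mult)
        then show ?thesis by (simp add: g_def cis del: complex_cnj_power)
      qed
      also have "\<dots> = qmul (qinv (K 0)) (K p)" by (rule qprod_telescope [OF KS refl])
      also have "K p = K 0" by (simp add: K_def cp flip: complex_cnj_power)
      finally show ?thesis using KS by simp
    qed
  qed
  note pow = this
  \<comment> \<open>\<open>phi p\<close> is deformed to \<open>qpow p\<close> and, the domain being
    contractible, \<open>Hh\<close> to 1. Both homotopies are free, yet the result is relative to
    \<open>B\<close>.\<close>
  have "homot_rel B X S3 (\<lambda>x. qmul (qinv (phi p (Hh x))) (phi p (qmul (Hh x) (E x))))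
     (\<lambda>x. qmul (qinv (qpow p qone)) (qpow p (qmul qone (E x))))"
  proof (rule homot_rel_twist [OF E ES E_B BX _ homot_phi_qpow])
    let ?c = "\<lambda>(v::real, z, w). (sc (of_real (1 - v)) z, of_real (1 - v) * w)"
    show "homot_rel {} X S3 Hh (\<lambda>x. qone)"
    proof (rule homot_rel_const_S3 [OF _ Hh(1) HhS, where c = ?c])
      have "((\<lambda>_. 0), 0) \<in> X" by (simp add: polydisc_def)
      then show "X \<noteq> {}" by blast
      show "continuous_on ({0..1} \<times> X) ?c" unfolding case_prod_unfold
        by (intro continuous_on_Pair continuous_on_act) (auto intro!: continuous_intros)
      show "?c (t, x) \<in> X" if "t \<in> {0..1}" "x \<in> X" for t x
      proof -
        obtain z w where x: "x = (z, w)" "z \<in> polydisc n" "norm w \<le> 1"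
          using \<open>x \<in> X\<close> by auto
        have le: "norm (complex_of_real (1 - t) * y) \<le> 1" if "norm y \<le> 1" for y
          unfolding norm_mult norm_of_real using that \<open>t \<in> {0..1}\<close> by (intro mult_le_one) auto
        have "sc (of_real (1 - t)) z \<in> polydisc n"
          unfolding polydisc_def mem_Collect_eq
        proof
          fix i show "if i < n then norm (sc (of_real (1 - t)) z i) \<le> 1 else sc (of_real (1 - t)) z i = 0"
            using x(2) le [of "z i"] by (auto simp: polydisc_def act_def split: if_splits)
        qed
        then show ?thesis using le [OF x(3)] by (simp add: x(1))
      qed
      show "?c (0, x) = x" for x by (cases x) simp
      show "?c (1, x) = ((\<lambda>_. 0), 0)" for x by (cases x) (simp add: act_def)
    qed
  qed simp_all
  then have "homot_rel B X S3 (\<lambda>x. qmul (qinv (phi p (Hh x))) (phi p (qmul (Hh x) (E x)))) (\<lambda>x. qpow p (E x))"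
    by simp
  from homot_rel_trans [OF this pow BX]
  have "homot_rel B X S3 (\<lambda>x. qmul (phi p (Hh x)) (qmul (qinv (phi p (Hh x))) (phi p (qmul (Hh x) (E x)))))
      (\<lambda>x. qmul (phi p (Hh x)) qone)"
    by (rule homot_rel_qmul_left) (use HhS in \<open>auto intro!: continuous_on_compose2 [OF continuous_on_phi Hh(1)]\<close>)
  then show ?thesis
    by (rule homot_rel_cong [OF _ BX]) (use HhS in \<open>auto simp: E_def\<close>)
qed

text \<open>The witnesses are the previous extensions composed with \<open>phi p\<close>. In the
  exponent \<open>p * N * p\<close> one factor \<open>p\<close> comes from rescaling the old
  weights, the other from \<open>phi_tau\<close>.\<close>

lemma extend:
  "\<exists>F' T'. homot_rel B X S3 F' T' \<and>
     (\<forall>z w. (z, w) \<in> X \<longrightarrow> F' (sc (zeta p) z, zeta p * w) = sig (zeta p) (F' (z, w))) \<and>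
     (\<forall>t z w. norm t = 1 \<longrightarrow> (z, w) \<in> X \<longrightarrow> T' (act a (t ^ p) z, t * w) = tau (t ^ (p * N * p)) (T' (z, w)))"
proof -
  obtain Hh where Hh: "continuous_on X Hh"
    "\<And>z r s j. z \<in> polydisc n \<Longrightarrow> r \<in> {0..1} \<Longrightarrow> s \<in> {0..1} \<Longrightarrow> Hh (z, pol p j r s) = H z r s"
    using H_glues by blast
  obtain F' where F': "continuous_on X F'"
    "\<And>z r s j. z \<in> polydisc n \<Longrightarrow> r \<in> {0..1} \<Longrightarrow> s \<in> {0..1} \<Longrightarrow>
      F' (z, pol p j r s) = sig (zeta p ^ j) (H (sc (cnj (zeta p ^ j)) z) r s)"
    using translated_H_glues by blast
  have "homot_rel B X S3 (\<lambda>x. phi p (T' x)) (\<lambda>x. phi p (Hh x))"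
    by (rule homot_rel_compose_left [OF homot_T'_H [OF Hh(2)] continuous_on_phi]) simp_all
  from homot_rel_trans [OF homot_phi_F'_H [OF Hh F'] homot_rel_sym [OF this BX] BX]
  have 1: "homot_rel B X S3 (\<lambda>x. phi p (F' x)) (\<lambda>x. phi p (T' x))" .
  have 2: "phi p (F' (sc (zeta p) z, zeta p * w)) = sig (zeta p) (phi p (F' (z, w)))" if zw: "(z, w) \<in> X" for z w
  proof -
    obtain j r s where js: "z \<in> polydisc n" "r \<in> {0..1}" "s \<in> {0..1}" "w = pol p j r s"
      by (rule polE [OF zw])
    \<comment> \<open>Multiplication by \<open>zeta p\<close> moves \<open>w\<close> into sector
      \<open>Suc j\<close>; the extra inverse rotation used there cancels the rotation of
      \<open>z\<close>.\<close>
    have "cnj (zeta p ^ Suc j) * zeta p = cnj (zeta p ^ j)"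
      using unit_cnj(2) [of "zeta p"] by (simp add: mult_ac)
    then have "F' (sc (zeta p) z, zeta p * w) = sig (zeta p ^ Suc j) (H (sc (cnj (zeta p ^ j)) z) r s)"
      using js F'(2) [of "sc (zeta p) z" r s "Suc j"] unfolding pol_Suc
      by (simp only: act_polydisc norm_zeta act_mult [symmetric])
    also have "\<dots> = sig (zeta p) (F' (z, w))" using js F'(2) [of z r s j] by (simp add: sig_mult)
    finally show ?thesis by (simp add: phi_sig)
  qed
  have 3: "phi p (T' (act a (t ^ p) z, t * w)) = tau (t ^ (p * N * p)) (phi p (T' (z, w)))"
    if "norm t = 1" "(z, w) \<in> X" for t z w
    using that by (simp add: T'_equiv phi_tau norm_power power_mult)
  show ?thesis using 1 2 3 by blast
qed

end

text \<open>On the boundary \<open>F\<close> and \<open>T\<close> agree, so their common restriction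
  is equivariant under both factors. Positive weights keep the circle characters nontrivial.\<close>

lemma equivariant_tower:
  assumes p: "0 < p"
  shows "\<exists>a N F T. 0 < N \<and> (\<forall>i<n. 0 < a i) \<and> homot_rel (pbdry n) (polydisc n) S3 F T \<and>
    (\<forall>z\<in>polydisc n. F (sc (zeta p) z) = sig (zeta p) (F z)) \<and>
    (\<forall>t. \<forall>z\<in>polydisc n. norm t = 1 \<longrightarrow> T (act a t z) = tau (t ^ N) (T z))"
proof (induction n)
  case 0
  have X: "polydisc 0 = {\<lambda>_. 0}" by (auto simp: polydisc_def)
  \<comment> \<open>Over a point \<open>F\<close> must be fixed by \<open>sig\<close> and
    \<open>T\<close> by \<open>tau\<close>; the fixed points 1 and \<open>(1, 0)\<close> are joined
    by a path in \<open>S3\<close>.\<close>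
  have "homot_rel {} (polydisc 0) S3 (\<lambda>_. (1, 0)) (\<lambda>_. qone)"
    by (rule homot_rel_const_S3 [where c = snd]) (auto simp: X S3_iff intro!: continuous_intros)
  then have "homot_rel (pbdry 0) (polydisc 0) S3 (\<lambda>_. qone) (\<lambda>_. (1, 0))"
    by (simp add: pbdry_def homot_rel_sym)
  then show ?case
    by - (rule exI [of _ "\<lambda>_. 1"], rule exI [of _ 1], rule exI [of _ "\<lambda>_. qone"],
      rule exI [of _ "\<lambda>_. (1, 0)"], simp add: tau_def)
next
  case (Suc n)
  then obtain a N F T where IH: "0 < N" "\<forall>i<n. 0 < a i" "homot_rel (pbdry n) (polydisc n) S3 F T"
    "\<forall>z\<in>polydisc n. F (sc (zeta p) z) = sig (zeta p) (F z)"
    "\<forall>t. \<forall>z\<in>polydisc n. norm t = 1 \<longrightarrow> T (act a t z) = tau (t ^ N) (T z)"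
    by blast
  obtain Q where Q: "continuous_on ({0..1::real} \<times> polydisc n) Q" "\<And>t x. t \<in> {0..1} \<Longrightarrow> x \<in> polydisc n \<Longrightarrow> Q (t, x) \<in> S3"
    "\<And>x. x \<in> polydisc n \<Longrightarrow> Q (0, x) = F x" "\<And>x. x \<in> polydisc n \<Longrightarrow> Q (1, x) = T x"
    "\<And>t x. t \<in> {0..1} \<Longrightarrow> x \<in> pbdry n \<Longrightarrow> Q (t, x) = F x"
    by (fact homot_relE [OF IH(3)])
  interpret extension_step p n N a F T Q
    by unfold_locales (use p Q IH(4,5) in auto)
  obtain F' T' where 1: "homot_rel B X S3 F' T'"
    and 2: "\<And>z w. (z, w) \<in> X \<Longrightarrow> F' (sc (zeta p) z, zeta p * w) = sig (zeta p) (F' (z, w))"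
    and 3: "\<And>t z w. norm t = 1 \<Longrightarrow> (z, w) \<in> X \<Longrightarrow> T' (act a (t ^ p) z, t * w) = tau (t ^ (p * N * p)) (T' (z, w))"
    using extend by blast
  define k where "k z = (z(n := 0), z n)" for z :: "nat \<Rightarrow> complex"
  \<comment> \<open>In \<open>extend\<close>, \<open>t\<close> acts on the old coordinates through
    \<open>t ^ p\<close> and on the new one with weight 1.\<close>
  define a' where "a' = (\<lambda>i. p * a i)(n := 1)"
  have kX: "k z \<in> X" if "z \<in> polydisc (Suc n)" for z
    using that less_Suc_eq by (auto simp: k_def polydisc_def)
  have "homot_rel (pbdry (Suc n)) (polydisc (Suc n)) S3 (\<lambda>z. F' (k z)) (\<lambda>z. T' (k z))"
  proof (rule homot_rel_compose_right [OF 1 _ kX])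
    have co: "continuous_on (polydisc (Suc n)) (\<lambda>z. z i)" for i
      by (rule continuous_on_product_then_coordinatewise [OF continuous_on_id])
    have "continuous_on (polydisc (Suc n)) (\<lambda>z. (z(n := 0)) i)" for i
      using co by (cases "i = n") simp_all
    then show "continuous_on (polydisc (Suc n)) k" unfolding k_def
      by (rule continuous_on_Pair [OF continuous_on_coordinatewise_then_product co])
    show "k z \<in> B" if "z \<in> pbdry (Suc n)" for z
    proof -
      have z: "z \<in> polydisc (Suc n)" and "\<exists>i<Suc n. norm (z i) = 1"
        using that by (simp_all only: pbdry_def mem_Collect_eq)
      then obtain i where i: "i < Suc n" "norm (z i) = 1" by (elim exE conjE)
      show ?thesis
      proof (cases "i = n")
        case True
        then show ?thesis using i kX [OF z] by (simp add: k_def)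
      next
        case False
        then have "z(n := 0) \<in> pbdry n" using i kX [OF z] by (auto simp: k_def pbdry_def intro!: exI [of _ i])
        then show ?thesis using kX [OF z] by (simp add: k_def)
      qed
    qed
  qed
  moreover have "F' (k (sc (zeta p) z)) = sig (zeta p) (F' (k z))" if "z \<in> polydisc (Suc n)" for z
  proof -
    have "k (sc (zeta p) z) = (sc (zeta p) (z(n := 0)), zeta p * z n)" by (auto simp: k_def act_def)
    then show ?thesis using 2 kX [OF that] unfolding k_def by metis
  qed
  moreover have "T' (k (act a' t z)) = tau (t ^ (p * N * p)) (T' (k z))"
    if "z \<in> polydisc (Suc n)" "norm t = 1" for z t
  proof -
    have "(act a' t z)(n := 0) = act a (t ^ p) (z(n := 0))" "act a' t z n = t * z n"
      by (auto simp: act_def a'_def power_mult)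
    then show ?thesis using 3 [OF that(2)] kX [OF that(1)] by (simp add: k_def)
  qed
  moreover have "0 < p * N * p" "\<forall>i<Suc n. 0 < a' i" using p IH(1,2) by (auto simp: a'_def)
  ultimately show ?case by blast
qed

section \<open>Real representations from characters\<close>

definition cv :: "(nat \<Rightarrow> real) \<Rightarrow> nat \<Rightarrow> complex" where
  "cv x i = Complex (x (2 * i)) (x (2 * i + 1))"

definition rv :: "(nat \<Rightarrow> complex) \<Rightarrow> nat \<Rightarrow> real" where
  "rv z k = (if even k then Re (z (k div 2)) else Im (z (k div 2)))"

lemma cv_rv [simp]: "cv (rv z) = z"
  by (auto simp: cv_def rv_def)

lemma rv_cv [simp]: "rv (cv x) = x"
proof
  fix k show "rv (cv x) k = x k"
    by (cases "even k") (auto simp: cv_def rv_def elim!: evenE oddE)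
qed

lemma vecs_cv: "x \<in> vecs (2 * n) \<longleftrightarrow> (\<forall>i\<ge>n. cv x i = 0)"
proof
  show "\<forall>i\<ge>n. cv x i = 0" if "x \<in> vecs (2 * n)"
    using that by (simp add: vecs_def cv_def Complex_eq_0)
  assume *: "\<forall>i\<ge>n. cv x i = 0"
  have "rv (cv x) k = 0" if "k \<ge> 2 * n" for k
    using * that unfolding rv_def by simp
  then show "x \<in> vecs (2 * n)" by (simp add: vecs_def)
qed

lemma sqnorm_cv: "sqnorm (2 * n) x = (\<Sum>i<n. (norm (cv x i))\<^sup>2)"
  by (induction n) (simp_all add: sqnorm_def cv_def cmod_def)

lemma cv_add: "cv (\<lambda>i. x i + y i) = (\<lambda>i. cv x i + cv y i)"
  and cv_scale: "cv (\<lambda>i. c * x i) = (\<lambda>i. of_real c * cv x i)"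
  by (auto simp: cv_def complex_eq_iff)

lemma rv_add: "rv (\<lambda>i. z i + w i) = (\<lambda>i. rv z i + rv w i)"
  and rv_scale: "rv (\<lambda>i. of_real c * z i) = (\<lambda>i. c * rv z i)"
  by (auto simp: rv_def)

lemma continuous_on_cv: "continuous_on X (\<lambda>x. cv x i)"
  unfolding cv_def Complex_eq
  by (intro continuous_intros continuous_on_product_then_coordinatewise continuous_on_id)

lemma continuous_on_rv:
  assumes "\<And>i. continuous_on X (\<lambda>x. f x i)" shows "continuous_on X (\<lambda>x. rv (f x))"
proof (rule continuous_on_coordinatewise_then_product)
  show "continuous_on X (\<lambda>x. rv (f x) k)" for k
    by (cases "even k") (simp_all add: rv_def continuous_on_Re continuous_on_Im assms)
qed

lemma fpf_orth_rep_characters: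
  fixes G :: "'g::topological_space set" and ch :: "nat \<Rightarrow> 'g \<Rightarrow> complex"
  assumes "\<And>i g. g \<in> G \<Longrightarrow> norm (ch i g) = 1" "\<And>i. continuous_on G (ch i)" "\<And>i. ch i e = 1"
    "\<And>i g h. g \<in> G \<Longrightarrow> h \<in> G \<Longrightarrow> ch i (gmul g h) = ch i g * ch i h"
    "\<And>i. i < n \<Longrightarrow> \<exists>g\<in>G. ch i g \<noteq> 1"
  shows "fpf_orth_rep G gmul e (2 * n) (\<lambda>g x. rv (\<lambda>i. ch i g * cv x i))"
  unfolding fpf_orth_rep_def
proof (intro conjI ballI allI impI)
  show "continuous_on (G \<times> vecs (2 * n)) (\<lambda>(g, x). rv (\<lambda>i. ch i g * cv x i))"
    unfolding case_prod_unfold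
    by (intro continuous_on_rv continuous_on_mult continuous_on_compose2 [OF assms(2)] continuous_on_compose2 [OF continuous_on_cv])
       (auto intro: continuous_on_fst continuous_on_snd continuous_on_id)
  fix x assume x: "x \<in> vecs (2 * n)" and fixed: "\<forall>g\<in>G. rv (\<lambda>i. ch i g * cv x i) = x"
  have "cv x i = 0" for i
  proof (cases "i < n")
    case True
    then obtain g where g: "g \<in> G" "ch i g \<noteq> 1" using assms(5) by blast
    have "ch i g * cv x i = cv x i" using fixed g(1) by (metis cv_rv)
    then show ?thesis using g(2) by simp
  qed (use x in \<open>simp add: vecs_cv\<close>)
  then have "cv x = (\<lambda>_. 0)" by (rule ext)
  then have "x = rv (\<lambda>_. 0)" using rv_cv [of x] by metis
  then show "x = (\<lambda>i. 0)" by (simp add: rv_def fun_eq_iff)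
qed (simp_all add: assms vecs_cv sqnorm_cv cv_add cv_scale distrib_left rv_add norm_mult mult.assoc mult.left_commute flip: rv_scale)

section \<open>From the round sphere to the boundary of the polydisc\<close>

primrec mx :: "nat \<Rightarrow> (nat \<Rightarrow> complex) \<Rightarrow> real" where
  "mx 0 z = 0"
| "mx (Suc n) z = max (mx n z) (norm (z n))"

lemma mx_nonneg: "0 \<le> mx n z" by (induction n) auto
lemma norm_le_mx: "i < n \<Longrightarrow> norm (z i) \<le> mx n z"
  by (induction n) (auto simp: less_Suc_eq)
lemma mx_attained: "mx n z \<noteq> 0 \<Longrightarrow> \<exists>i<n. norm (z i) = mx n z"
  by (induction n) (auto simp: max_def less_Suc_eq split: if_splits)
lemma mx_cong: "(\<And>i. norm (z i) = norm (w i)) \<Longrightarrow> mx n z = mx n w"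
  by (induction n) auto
lemma continuous_on_mx: "(\<And>i. continuous_on X (\<lambda>x. f x i)) \<Longrightarrow> continuous_on X (\<lambda>x. mx n (f x))"
  by (induction n) (auto intro!: continuous_intros)

text \<open>Scaling by the maximum norm carries the sphere into the boundary of the polydisc. Since
  \<open>mx\<close> sees only the norms of coordinates, this commutes with unit characters.\<close>

lemma mx_scaled_pbdry:
  assumes "\<forall>i\<ge>n. z i = 0" "mx n z \<noteq> 0"
  shows "(\<lambda>i. z i / of_real (mx n z)) \<in> pbdry n"
  using assms mx_nonneg [of n z] norm_le_mx [of _ n z] mx_attained [OF assms(2)]
  by (auto simp: pbdry_def polydisc_def norm_divide)

section \<open>Characters of the group and the bound 4\<close>

definition chr :: "nat \<Rightarrow> nat \<Rightarrow> nat \<Rightarrow> complex \<times> nat \<Rightarrow> complex" where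
  "chr p a b g = fst g ^ a * zeta p ^ (b * snd g)"

lemma zeta_pow_mod: "0 < p \<Longrightarrow> zeta p ^ (b * (k mod p)) = zeta p ^ (b * k)"
proof -
  assume "0 < p"
  then have "(zeta p ^ b) ^ p = 1" by (metis power_mult mult.commute zeta_pow_p power_one)
  then have "(zeta p ^ b) ^ (k mod p + p * (k div p)) = (zeta p ^ b) ^ (k mod p)"
    by (simp only: power_add power_mult power_one mult_1_right)
  then show ?thesis by (simp add: power_mult)
qed

lemma zeta_neq_1: "1 < p \<Longrightarrow> zeta p \<noteq> 1"
  using complex_root_unity_eq_1 [of p 1] by (simp add: zeta_def cis_conv_exp mult_ac)

lemma chr_props:
  assumes "0 < p"
  shows "g \<in> S1Cp p \<Longrightarrow> norm (chr p a b g) = 1" "continuous_on Y (chr p a b)" "chr p a b (1, 0) = 1"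
    "chr p a b (S1Cp_mult p g h) = chr p a b g * chr p a b h"
proof -
  show "norm (chr p a b g) = 1" if "g \<in> S1Cp p"
    using that by (auto simp: chr_def S1Cp_def norm_mult norm_power)
  have "continuous_on Y (\<lambda>g. zeta p ^ (b * snd g))"
    by (rule continuous_on_compose2 [of UNIV "\<lambda>k. zeta p ^ (b * k)"]) (auto intro!: continuous_intros)
  then show "continuous_on Y (chr p a b)"
    unfolding chr_def by (intro continuous_intros)
  show "chr p a b (1, 0) = 1" by (simp add: chr_def)
  show "chr p a b (S1Cp_mult p g h) = chr p a b g * chr p a b h"
    by (simp add: chr_def S1Cp_mult_def zeta_pow_mod [OF assms] power_mult_distrib distrib_left power_add)
qed

lemma ex_power_neq_1:
  assumes "0 < a" obtains t :: complex where "norm t = 1" "t ^ a \<noteq> 1"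
proof
  show "cis (pi / real a) ^ a \<noteq> 1" using assms by (simp add: Complex.DeMoivre)
qed simp

text \<open>The target is a sum of two complex characters, hence of real dimension 4. The source has
  real dimension \<open>2 * n\<close>, which is at least \<open>n\<close>.\<close>

lemma bu_fun_le_4:
  assumes p: "1 < p"
  shows "bu_fun (S1Cp p) (S1Cp_mult p) (1, 0) n \<le> 4"
proof -
  have p0: "0 < p" using p by simp
  obtain a N F T where N: "0 < N" and a: "\<forall>i<n. 0 < a i"
    and hom: "homot_rel (pbdry n) (polydisc n) S3 F T"
    and F: "\<forall>z\<in>polydisc n. F (sc (zeta p) z) = sig (zeta p) (F z)"
    and T: "\<forall>t. \<forall>z\<in>polydisc n. norm t = 1 \<longrightarrow> T (act a t z) = tau (t ^ N) (T z)"
    using equivariant_tower [OF p0, of n] by (elim exE conjE)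
  define V where "V i = chr p (a i) 1" for i
  \<comment> \<open>Coordinate 0 carries the \<open>sig\<close>-action of C_p, coordinate 1 the
    \<open>tau\<close>-action of the circle.\<close>
  define W where "W i = (if i = 0 then chr p 0 1 else chr p N 0)" for i :: nat
  define rho where "rho g x = rv (\<lambda>i. V i g * cv x i)" for g x
  define sgm where "sgm g x = rv (\<lambda>i. W i g * cv x i)" for g x
  have V: "fpf_orth_rep (S1Cp p) (S1Cp_mult p) (1, 0) (2 * n) rho" unfolding rho_def
  proof (rule fpf_orth_rep_characters)
    fix i assume "i < n"
    then obtain t :: complex where "norm t = 1" "t ^ a i \<noteq> 1" using a ex_power_neq_1 by metis
    then show "\<exists>g\<in>S1Cp p. V i g \<noteq> 1"
      using p0 by (intro bexI [of _ "(t, 0)"]) (auto simp: V_def chr_def S1Cp_def)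
  qed (simp_all add: V_def chr_props [OF p0])
  have W: "fpf_orth_rep (S1Cp p) (S1Cp_mult p) (1, 0) (2 * 2) sgm" unfolding sgm_def
  proof (rule fpf_orth_rep_characters)
    fix i :: nat assume "i < 2"
    obtain t :: complex where t: "norm t = 1" "t ^ N \<noteq> 1" using N ex_power_neq_1 by metis
    have "(1, 1) \<in> S1Cp p" "(t, 0) \<in> S1Cp p" using t p by (auto simp: S1Cp_def)
    moreover have "chr p 0 1 (1, 1) \<noteq> 1" "chr p N 0 (t, 0) \<noteq> 1"
      using t zeta_neq_1 [OF p] by (simp_all add: chr_def)
    ultimately show "\<exists>g\<in>S1Cp p. W i g \<noteq> 1" unfolding W_def by metis
  qed (simp_all add: W_def chr_props [OF p0])
  define nz where "nz x = (\<lambda>i. cv x i / of_real (mx n (cv x)))" for x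
  define f where "f x = rv (\<lambda>i. if i = 0 then fst (F (nz x)) else if i = 1 then snd (F (nz x)) else 0)" for x
  have mx0: "mx n (cv x) \<noteq> 0" if "x \<in> sph (2 * n)" for x
  proof
    assume "mx n (cv x) = 0"
    then have "cv x i = 0" if "i < n" for i using norm_le_mx [OF that, of "cv x"] by simp
    then have "sqnorm (2 * n) x = 0" by (simp add: sqnorm_cv)
    then show False using that by (simp add: sph_def)
  qed
  have nz: "nz x \<in> pbdry n" if "x \<in> sph (2 * n)" for x
    unfolding nz_def using that mx0 by (intro mx_scaled_pbdry) (auto simp: sph_def vecs_cv)
  have Fc: "continuous_on (polydisc n) F" and FS: "\<And>z. z \<in> polydisc n \<Longrightarrow> F z \<in> S3"
    and FT: "\<And>z. z \<in> pbdry n \<Longrightarrow> T z = F z"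
    using homot_rel_imp [OF hom] pbdry_subset by auto
  have Fk: "F (sc (zeta p ^ k) z) = sig (zeta p ^ k) (F z)" if "z \<in> polydisc n" for k z
    by (induction k) (use that F in \<open>simp_all add: act_mult sig_mult\<close>)
  have "equiv_sphere_map (S1Cp p) (2 * n) rho (2 * 2) sgm f"
    unfolding equiv_sphere_map_def
  proof (intro conjI ballI subsetI)
    have "continuous_on (sph (2 * n)) nz" unfolding nz_def
      by (intro continuous_on_coordinatewise_then_product continuous_intros continuous_on_mx continuous_on_cv) (use mx0 in auto)
    then have c: "continuous_on (sph (2 * n)) (\<lambda>x. F (nz x))"
      by (rule continuous_on_compose2 [OF Fc]) (use nz pbdry_subset in blast)
    show "continuous_on (sph (2 * n)) f" unfolding f_def
    proof (rule continuous_on_rv)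
      show "continuous_on (sph (2 * n)) (\<lambda>x. if i = 0 then fst (F (nz x)) else if i = 1 then snd (F (nz x)) else 0)" for i :: nat
        using c by (cases "i = 0"; cases "i = 1") (auto intro!: continuous_on_fst continuous_on_snd)
    qed
    show "y \<in> sph (2 * 2)" if y: "y \<in> f ` sph (2 * n)" for y
    proof -
      obtain x where x: "x \<in> sph (2 * n)" "y = f x" using y by blast
      then have "F (nz x) \<in> S3" using nz pbdry_subset by (intro FS) blast
      then show ?thesis unfolding sph_def mem_Collect_eq vecs_cv sqnorm_cv x(2) f_def
        by (simp add: S3_iff numeral_2_eq_2)
    qed
    fix g x assume g: "g \<in> S1Cp p" and x: "x \<in> sph (2 * n)"
    obtain t k where tk: "g = (t, k)" "norm t = 1" using g by (auto simp: S1Cp_def)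
    have "mx n (cv (rho g x)) = mx n (cv x)"
      by (rule mx_cong) (simp add: rho_def norm_mult V_def chr_props [OF p0] g)
    then have "nz (rho g x) = act a t (sc (zeta p ^ k) (nz x))"
      by (auto simp: nz_def rho_def V_def chr_def tk act_def)
    moreover have z: "nz x \<in> pbdry n" "nz x \<in> polydisc n" using nz [OF x] pbdry_subset by auto
    \<comment> \<open>At boundary points \<open>F\<close> and \<open>T\<close> may be exchanged:
      \<open>T\<close> handles the circle factor and \<open>F\<close> the factor C_p.\<close>
    ultimately have "F (nz (rho g x)) = tau (t ^ N) (sig (zeta p ^ k) (F (nz x)))"
      using T tk(2) FT [of "act a t (sc (zeta p ^ k) (nz x))"] FT [of "sc (zeta p ^ k) (nz x)"] Fk by simp
    then show "f (rho g x) = sgm g (f x)"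
      by (auto simp: f_def sgm_def W_def chr_def tk tau_def sig_def intro!: arg_cong [where f = rv])
  qed
  then have "\<exists>m rho sig f. m \<ge> n \<and> fpf_orth_rep (S1Cp p) (S1Cp_mult p) (1, 0) m rho \<and>
      fpf_orth_rep (S1Cp p) (S1Cp_mult p) (1, 0) 4 sig \<and> equiv_sphere_map (S1Cp p) m rho 4 sig f"
    using V W by (intro exI [of _ "2 * n"] exI [of _ rho] exI [of _ sgm] exI [of _ f]) simp
  then show ?thesis unfolding bu_fun_def by (rule Least_le)
qed

theorem theorem1p1:
  fixes p :: nat
  assumes "prime p"
  shows "\<not> weak_BU_property (S1Cp p) (S1Cp_mult p) (1, 0)"
proof -
  have "bdd_above (range (bu_fun (S1Cp p) (S1Cp_mult p) (1, 0)))"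
    using bu_fun_le_4 prime_gt_1_nat [OF assms] by (intro bdd_aboveI [of _ 4]) auto
  then show ?thesis by (simp add: weak_BU_property_def)
qed

end
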